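(* Let $N'\ge1$ be an integer, $N=2N'$, and let $(g_{\mathfrak b},h_{\mathfrak b})$, $\mathfrak b>0$, be Yang's family of $S^1$-symmetric Einstein-Bogomol'nyi metrics on $\mathbf{P}^1$ with Higgs field $\boldsymbol\phi=z_0^{N'}z_1^{N'}\in H^0(\mathcal{O}_{\mathbf{P}^1}(2N'))$. As $\mathfrak b\to0^+$: $\mathrm{diam}(\mathbf{P}^1,g_{\mathfrak b})\to+\infty$; and, in the cylindrical coordinates $(t,\theta)\in\mathbf{R}\times S^1$ of $\mathbf{C}^*=\mathbf{P}^1\setminus\{0,\infty\}$, smoothly on every compact subset of $\mathbf{R}\times S^1$, the metric $g_{\mathfrak b}$ converges to the flat cylindrical metric $N(dt^2+d\theta^2)$, the Hermitian metric $h_{\mathfrak b}$ (in the standard trivialization over $\mathbf{C}$) converges to $h_\infty=e^{-2N't}$, which has vanishing curvature, and $|\boldsymbol\phi|_{h_{\mathfrak b}}^2$ converges to the constant function $1$. In particular, for a base point $p$ fixed on the central equator $\{t=0\}$, $(\mathbf{P}^1,g_{\mathfrak b},p)$ converges in the pointed Cheeger-Gromov sense to the flat cylinder $(\mathbf{R}\times S^1,N(dt^2+d\theta^2),p)$.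
   Context: Here $\tau=1$ and $\alpha=\frac1{2N'}$. On $\mathbf{C}^*\subset\mathbf{P}^1$ use the coordinates $z=re^{i\theta}$, $r=e^t$, $(t,\theta)\in\mathbf{R}\times S^1$; in the standard trivialization over $\mathbf{C}$ the section $\boldsymbol\phi$ is $z^{N'}$. For each $\mathfrak b>0$ let $\lambda_{\mathfrak b}=\frac{1}{2N'e^{2\alpha(\mathfrak b+e^{-\mathfrak b})}}$ and let $u^{\mathfrak b}:\mathbf{R}\to\mathbf{R}$ be the global solution of $$u_{tt}=\frac1{\lambda_{\mathfrak b}}e^{2\alpha(u-e^u)}(e^u-1),\qquad u(0)=-\mathfrak b,\quad u_t(0)=0,$$ which satisfies $\lim_{t\to\pm\infty}u_t(t)=\mp2N'$ (Yang). Define $h_{\mathfrak b}$ by $|\boldsymbol\phi|_{h_{\mathfrak b}}^2=e^{u^{\mathfrak b}(t)}$, i.e. $h_{\mathfrak b}=e^{u^{\mathfrak b}(t)-2N't}$ in the standard trivialization over $\mathbf{C}$, and $g_{\mathfrak b}=\frac1{\lambda_{\mathfrak b}}e^{2\alpha(u^{\mathfrak b}-e^{u^{\mathfrak b}})}(dt^2+d\theta^2)$; both extend smoothly to $\mathbf{P}^1$ and form an Einstein-Bogomol'nyi metric, i.e. (with $\omega$ the K\"ahler form) solve $iF_h+\frac12(|\boldsymbol\phi|_h^2-1)\omega=0$, $S_\omega+\alpha(\Delta_\omega+1)(|\boldsymbol\phi|_h^2-1)=0$ with $F_h=-\partial\bar\partial\log h$, $\Delta_\omega\eta=\mathrm{tr}_\omega(-2i\partial\bar\partial\eta)$,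 $S_\omega=\mathrm{tr}_\omega\mathrm{Ric}\,\omega$. *)

theory Defs
  imports "HOL-Analysis.Analysis"
begin

section \<open>Smooth maps and smooth convergence in Euclidean spaces\<close>

primrec partials :: "'e::euclidean_space list \<Rightarrow> ('e \<Rightarrow> 'f::real_normed_vector) \<Rightarrow> 'e \<Rightarrow> 'f" where
  "partials [] f = f"
| "partials (v # vs) f = (\<lambda>x. frechet_derivative (partials vs f) (at x) v)"

text \<open>Only used for open \<open>S\<close>.\<close>

definition smooth_on :: "'e::euclidean_space set \<Rightarrow> ('e \<Rightarrow> 'f::real_normed_vector) \<Rightarrow> bool" where
  "smooth_on S f \<longleftrightarrow> (\<forall>vs \<in> lists Basis. partials vs f differentiable_on S)"

definition smooth_limit ::
    "'e::euclidean_space set \<Rightarrow> ('i \<Rightarrow> 'e \<Rightarrow> 'f::real_normed_vector) \<Rightarrow> ('e \<Rightarrow> 'f) \<Rightarrow> 'i filter \<Rightarrow> bool" where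
  "smooth_limit K f l F \<longleftrightarrow>
     (\<forall>vs \<in> lists Basis. uniform_limit K (\<lambda>i. partials vs (f i)) (partials vs l) F)"


section \<open>Manifolds given by parametrizations\<close>

text \<open>A smooth manifold is given by a family of injective parametrizations \<open>(U, x)\<close>, with
  \<open>U\<close> open in the Euclidean space \<open>'e\<close>, whose images cover the manifold and whose transition maps
  \<open>inv_into U' x' \<circ> x\<close> are smooth on open sets.\<close>

type_synonym ('e, 'm) param = "'e set \<times> ('e \<Rightarrow> 'm)"
type_synonym ('e, 'm) atlas = "('e, 'm) param set"

definition carrier_of :: "('e, 'm) atlas \<Rightarrow> 'm set" where
  "carrier_of M = (\<Union>(U, x) \<in> M. x ` U)"

definition manifold_topology :: "('e::euclidean_space, 'm) atlas \<Rightarrow> 'm topology" where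
  "manifold_topology M =
     topology (\<lambda>S. S \<subseteq> carrier_of M \<and> (\<forall>(U, x) \<in> M. open {y \<in> U. x y \<in> S}))"

lemma openin_manifold_topology:
  assumes "\<And>U x. (U, x) \<in> M \<Longrightarrow> open U"
  shows "openin (manifold_topology M) S \<longleftrightarrow>
           S \<subseteq> carrier_of M \<and> (\<forall>(U, x) \<in> M. open {y \<in> U. x y \<in> S})"
proof -
  have "istopology (\<lambda>S. S \<subseteq> carrier_of M \<and> (\<forall>(U, x) \<in> M. open {y \<in> U. x y \<in> S}))"
    unfolding istopology_def
  proof (intro conjI allI impI ballI; (elim conjE)?)
    fix S T
    assume S: "\<forall>(U, x) \<in> M. open {y \<in> U. x y \<in> S}" and T: "\<forall>(U, x) \<in> M. open {y \<in> U. x y \<in> T}"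
    have "{y \<in> U. x y \<in> S \<inter> T} = {y \<in> U. x y \<in> S} \<inter> {y \<in> U. x y \<in> T}" for U :: "'a set" and x
      by blast
    with S T show "case c of (U, x) \<Rightarrow> open {y \<in> U. x y \<in> S \<inter> T}" if "c \<in> M" for c
      using that by (auto intro!: open_Int)
  next
    fix \<K>
    assume K: "\<forall>S\<in>\<K>. S \<subseteq> carrier_of M \<and> (\<forall>(U, x) \<in> M. open {y \<in> U. x y \<in> S})"
    have "{y \<in> U. x y \<in> \<Union>\<K>} = (\<Union>S\<in>\<K>. {y \<in> U. x y \<in> S})" for U :: "'a set" and x
      by blast
    with K show "case c of (U, x) \<Rightarrow> open {y \<in> U. x y \<in> \<Union>\<K>}" if "c \<in> M" for c
      using that by (auto intro!: open_UN)
  qed (auto)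
  then show ?thesis
    unfolding manifold_topology_def by (simp add: topology_inverse')
qed

definition smooth_map_on ::
    "('e::euclidean_space, 'm) atlas \<Rightarrow> ('k::euclidean_space, 'n) atlas \<Rightarrow> 'm set \<Rightarrow> ('m \<Rightarrow> 'n) \<Rightarrow> bool" where
  "smooth_map_on M M' V f \<longleftrightarrow> f ` V \<subseteq> carrier_of M' \<and>
     (\<forall>(U, x) \<in> M. \<forall>(U', x') \<in> M'.
        let W = {y \<in> U. x y \<in> V \<and> f (x y) \<in> x' ` U'}
        in open W \<and> smooth_on W (inv_into U' x' \<circ> f \<circ> x))"

definition diffeo_onto_open ::
    "('e::euclidean_space, 'm) atlas \<Rightarrow> ('k::euclidean_space, 'n) atlas \<Rightarrow> 'm set \<Rightarrow> ('m \<Rightarrow> 'n) \<Rightarrow> bool" where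
  "diffeo_onto_open M M' V f \<longleftrightarrow>
     openin (manifold_topology M) V \<and> openin (manifold_topology M') (f ` V) \<and> inj_on f V \<and>
     smooth_map_on M M' V f \<and> smooth_map_on M' M (f ` V) (inv_into V f)"

text \<open>Convergence in the smooth topology on compact subsets of \<open>M\<close>. Every compact subset of \<open>M\<close> is
  a finite union of images of compact subsets of parameter domains.\<close>

definition smooth_conv ::
    "('e::euclidean_space, 'm) atlas \<Rightarrow> ('i \<Rightarrow> 'm \<Rightarrow> real) \<Rightarrow> ('m \<Rightarrow> real) \<Rightarrow> 'i filter \<Rightarrow> bool" where
  "smooth_conv M f l F \<longleftrightarrow>
     (\<forall>(U, x) \<in> M. \<forall>K. compact K \<and> K \<subseteq> U \<longrightarrow> smooth_limit K (\<lambda>i. f i \<circ> x) (l \<circ> x) F)"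


section \<open>Riemannian metrics\<close>

text \<open>A covariant 2-tensor is given by its local expression in each parametrization \<open>c\<close>:
  \<open>g c y v w\<close> is its value at the point with coordinates \<open>y\<close> on the coordinate vectors \<open>v\<close>, \<open>w\<close>.\<close>

type_synonym ('e, 'm) tensor2 = "('e, 'm) param \<Rightarrow> 'e \<Rightarrow> 'e \<Rightarrow> 'e \<Rightarrow> real"

definition riemannian_metric :: "('e::euclidean_space, 'm) atlas \<Rightarrow> ('e, 'm) tensor2 \<Rightarrow> bool" where
  "riemannian_metric M g \<longleftrightarrow>
     (\<forall>(U, x) \<in> M.
        (\<forall>y \<in> U. bilinear (g (U, x) y) \<and> (\<forall>v w. g (U, x) y v w = g (U, x) y w v) \<and>
                 (\<forall>v. v \<noteq> 0 \<longrightarrow> g (U, x) y v v > 0)) \<and>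
        (\<forall>v w. smooth_on U (\<lambda>y. g (U, x) y v w))) \<and>
     (\<forall>(U, x) \<in> M. \<forall>(U', x') \<in> M. \<forall>y \<in> U. x y \<in> x' ` U' \<longrightarrow>
        (let \<tau> = inv_into U' x' \<circ> x; D = frechet_derivative \<tau> (at y)
         in \<forall>v w. g (U, x) y v w = g (U', x') (\<tau> y) (D v) (D w)))"

definition param_at :: "('e, 'm) atlas \<Rightarrow> 'm \<Rightarrow> ('e, 'm) param" where
  "param_at M p = (SOME c. c \<in> M \<and> p \<in> snd c ` fst c)"

definition pullback ::
    "('k::euclidean_space, 'n) atlas \<Rightarrow> ('m \<Rightarrow> 'n) \<Rightarrow> ('k, 'n) tensor2 \<Rightarrow> ('e::euclidean_space, 'm) tensor2" where
  "pullback M' f g = (\<lambda>(U, x) y v w.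
     let c = param_at M' (f (x y));
         f' = inv_into (fst c) (snd c) \<circ> f \<circ> x;
         D = frechet_derivative f' (at y)
     in g c (f' y) (D v) (D w))"

definition smooth_conv_tensor2 ::
    "('e::euclidean_space, 'm) atlas \<Rightarrow> ('i \<Rightarrow> ('e, 'm) tensor2) \<Rightarrow> ('e, 'm) tensor2 \<Rightarrow> 'i filter \<Rightarrow> bool" where
  "smooth_conv_tensor2 M g l F \<longleftrightarrow>
     (\<forall>(U, x) \<in> M. \<forall>K. compact K \<and> K \<subseteq> U \<longrightarrow>
        (\<forall>v \<in> Basis. \<forall>w \<in> Basis.
           smooth_limit K (\<lambda>i y. g i (U, x) y v w) (\<lambda>y. l (U, x) y v w) F))"

definition piecewise_C1_curve :: "('e::euclidean_space, 'm) atlas \<Rightarrow> (real \<Rightarrow> 'm) \<Rightarrow> bool" where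
  "piecewise_C1_curve M \<gamma> \<longleftrightarrow> \<gamma> ` {0..1} \<subseteq> carrier_of M \<and>
     (\<forall>t \<in> {0..1}. \<forall>(U, x) \<in> M. \<gamma> t \<in> x ` U \<longrightarrow>
        (\<exists>e>0. \<gamma> ` ({0..1} \<inter> {t - e..t + e}) \<subseteq> x ` U \<and>
               (inv_into U x \<circ> \<gamma>) piecewise_C1_differentiable_on ({0..1} \<inter> {t - e..t + e})))"

definition speed :: "('e::euclidean_space, 'm) atlas \<Rightarrow> ('e, 'm) tensor2 \<Rightarrow> (real \<Rightarrow> 'm) \<Rightarrow> real \<Rightarrow> real" where
  "speed M g \<gamma> t =
     (let c = param_at M (\<gamma> t);
          \<gamma>' = inv_into (fst c) (snd c) \<circ> \<gamma>;
          v = vector_derivative \<gamma>' (at t)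
      in sqrt (g c (\<gamma>' t) v v))"

text \<open>The library notion of a piecewise C1 curve allows the velocity to be unbounded near
  finitely many parameters, so the length takes values in \<open>[0, \<infinity>]\<close>; this does not affect the
  infimum in the distance.\<close>

definition curve_length ::
    "('e::euclidean_space, 'm) atlas \<Rightarrow> ('e, 'm) tensor2 \<Rightarrow> (real \<Rightarrow> 'm) \<Rightarrow> ennreal" where
  "curve_length M g \<gamma> = (\<integral>\<^sup>+ t \<in> {0..1}. ennreal (speed M g \<gamma> t) \<partial>lborel)"

definition riem_dist :: "('e::euclidean_space, 'm) atlas \<Rightarrow> ('e, 'm) tensor2 \<Rightarrow> 'm \<Rightarrow> 'm \<Rightarrow> ennreal" where
  "riem_dist M g p q =
     (INF \<gamma> \<in> {\<gamma>. piecewise_C1_curve M \<gamma> \<and> \<gamma> 0 = p \<and> \<gamma> 1 = q}. curve_length M g \<gamma>)"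

definition riem_diam :: "('e::euclidean_space, 'm) atlas \<Rightarrow> ('e, 'm) tensor2 \<Rightarrow> ennreal" where
  "riem_diam M g = (SUP p \<in> carrier_of M. SUP q \<in> carrier_of M. riem_dist M g p q)"

definition riem_ball ::
    "('e::euclidean_space, 'm) atlas \<Rightarrow> ('e, 'm) tensor2 \<Rightarrow> 'm \<Rightarrow> real \<Rightarrow> 'm set" where
  "riem_ball M g p r = {q \<in> carrier_of M. riem_dist M g p q < ennreal r}"

text \<open>Pointed Cheeger-Gromov convergence of \<open>(M' i, g' i, p' i)\<close> to \<open>(M, g, p)\<close> along a filter:
  \<open>V\<close> is an exhaustion of \<open>M\<close> by open sets and \<open>f i\<close> embeds \<open>V i\<close> in \<open>M' i\<close>. The last condition,
  that the images eventually contain every metric ball about the base point, is part of some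
  definitions in the literature and automatic if the metrics are complete.\<close>

definition pointed_cheeger_gromov ::
    "('i \<Rightarrow> ('k::euclidean_space, 'n) atlas) \<Rightarrow> ('i \<Rightarrow> ('k, 'n) tensor2) \<Rightarrow> ('i \<Rightarrow> 'n) \<Rightarrow>
     ('e::euclidean_space, 'm) atlas \<Rightarrow> ('e, 'm) tensor2 \<Rightarrow> 'm \<Rightarrow> 'i filter \<Rightarrow> bool" where
  "pointed_cheeger_gromov M' g' p' M g p F \<longleftrightarrow>
     (\<exists>V f.
        (\<forall>\<^sub>F i in F. p \<in> V i \<and> diffeo_onto_open M (M' i) (V i) (f i) \<and> f i p = p' i) \<and>
        (\<forall>K. compactin (manifold_topology M) K \<longrightarrow> (\<forall>\<^sub>F i in F. K \<subseteq> V i)) \<and>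
        smooth_conv_tensor2 M (\<lambda>i. pullback (M' i) (f i) (g' i)) g F \<and>
        (\<forall>r>0. \<forall>\<^sub>F i in F. riem_ball (M' i) (g' i) (p' i) r \<subseteq> f i ` V i))"


section \<open>The projective line and the cylinder\<close>

definition proj :: "complex \<times> complex \<Rightarrow> (complex \<times> complex) set" where
  "proj = (\<lambda>(z0, z1). {(c * z0, c * z1) | c. True})"

definition CP1 :: "(complex, (complex \<times> complex) set) atlas" where
  "CP1 = {(UNIV, \<lambda>z. proj (1, z)), (UNIV, \<lambda>w. proj (w, 1))}"

text \<open>The circle factor of the cylinder is the unit circle in \<open>\<complex>\<close>, and the parametrizations are
  \<open>(t, \<theta>) \<mapsto> (t, exp (\<i> \<theta>))\<close> with \<open>\<theta>\<close> in an open interval of length \<open>2 \<pi>\<close>.\<close>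

definition cylinder :: "(real \<times> real, real \<times> complex) atlas" where
  "cylinder = {({(t, \<theta>). a < \<theta> \<and> \<theta> < a + 2 * pi}, \<lambda>(t, \<theta>). (t, cis \<theta>)) | a. True}"

text \<open>The tensor \<open>\<rho> (dt\<^sup>2 + d\<theta>\<^sup>2)\<close> on the cylinder, for a function \<open>\<rho>\<close> of \<open>t\<close>.\<close>

definition cyl_tensor :: "(real \<Rightarrow> real) \<Rightarrow> (real \<times> real, real \<times> complex) tensor2" where
  "cyl_tensor \<rho> c y v w = \<rho> (fst y) * (v \<bullet> w)"

definition cyl_to_C :: "real \<times> complex \<Rightarrow> complex" where
  "cyl_to_C = (\<lambda>(t, \<omega>). of_real (exp t) * \<omega>)"

definition cyl_to_CP1 :: "real \<times> complex \<Rightarrow> (complex \<times> complex) set" where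
  "cyl_to_CP1 p = proj (1, cyl_to_C p)"


section \<open>Hermitian metrics on line bundles over the projective line\<close>

text \<open>The fibre of \<open>\<O>(d)\<close> over a line \<open>L\<close> consists of the functions on \<open>L\<close> that are homogeneous of
  degree \<open>d\<close>. A Hermitian metric is encoded by the function \<open>h\<close> on \<open>\<complex>\<^sup>2 - {0}\<close> for which the
  squared norm of \<open>s\<close> over the line through \<open>v\<close> is \<open>h v * \<bar>s v\<bar>\<^sup>2\<close>.\<close>

definition hermitian_metric_O :: "nat \<Rightarrow> (complex \<times> complex \<Rightarrow> real) \<Rightarrow> bool" where
  "hermitian_metric_O d h \<longleftrightarrow> smooth_on (- {0}) h \<and> (\<forall>v. v \<noteq> 0 \<longrightarrow> h v > 0) \<and>
     (\<forall>c z0 z1. c \<noteq> 0 \<and> (z0, z1) \<noteq> 0 \<longrightarrow> h (c * z0, c * z1) = h (z0, z1) / cmod c ^ (2 * d))"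

text \<open>The metric in the frame \<open>z0 ^ d\<close> of \<open>\<O>(d)\<close> over \<open>\<complex> = {z0 \<noteq> 0}\<close>, with \<open>z = z1 / z0\<close>.\<close>

definition std_triv :: "(complex \<times> complex \<Rightarrow> real) \<Rightarrow> complex \<Rightarrow> real" where
  "std_triv h z = h (1, z)"

definition higgs :: "nat \<Rightarrow> complex \<times> complex \<Rightarrow> complex" where
  "higgs N' = (\<lambda>(z0, z1). z0 ^ N' * z1 ^ N')"

text \<open>The squared norm over the point \<open>[1 : z]\<close>.\<close>

definition norm_sq :: "(complex \<times> complex \<Rightarrow> complex) \<Rightarrow> (complex \<times> complex \<Rightarrow> real) \<Rightarrow> complex \<Rightarrow> real" where
  "norm_sq s h z = h (1, z) * (cmod (s (1, z)))\<^sup>2"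

definition wirtinger :: "(complex \<Rightarrow> complex) \<Rightarrow> complex \<Rightarrow> complex" where
  "wirtinger f z =
     (frechet_derivative f (at z) 1 - \<i> * frechet_derivative f (at z) \<i>) / 2"

definition wirtinger_bar :: "(complex \<Rightarrow> complex) \<Rightarrow> complex \<Rightarrow> complex" where
  "wirtinger_bar f z =
     (frechet_derivative f (at z) 1 + \<i> * frechet_derivative f (at z) \<i>) / 2"

text \<open>The curvature 2-form \<open>- \<partial> \<partial>bar log h\<close> of a Hermitian metric \<open>h\<close> given in a holomorphic frame,
  evaluated at \<open>z\<close> on the tangent vectors \<open>v\<close>, \<open>w\<close>.\<close>

definition chern_curvature :: "(complex \<Rightarrow> real) \<Rightarrow> complex \<Rightarrow> complex \<Rightarrow> complex \<Rightarrow> complex" where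
  "chern_curvature h z v w =
     - wirtinger (wirtinger_bar (\<lambda>z. of_real (ln (h z)))) z * (v * cnj w - w * cnj v)"


section \<open>Yang's family\<close>

definition yang_alpha :: "nat \<Rightarrow> real" where
  "yang_alpha N' = 1 / (2 * N')"

definition yang_lambda :: "nat \<Rightarrow> real \<Rightarrow> real" where
  "yang_lambda N' b = 1 / (2 * N' * exp (2 * yang_alpha N' * (b + exp (- b))))"

definition yang_solution :: "nat \<Rightarrow> real \<Rightarrow> (real \<Rightarrow> real) \<Rightarrow> bool" where
  "yang_solution N' b u \<longleftrightarrow> u 0 = - b \<and> deriv u 0 = 0 \<and>
     (\<forall>t. u differentiable (at t) \<and>
          (deriv u has_real_derivative
             1 / yang_lambda N' b * exp (2 * yang_alpha N' * (u t - exp (u t))) * (exp (u t) - 1))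
          (at t))"

definition yang_factor :: "nat \<Rightarrow> real \<Rightarrow> (real \<Rightarrow> real) \<Rightarrow> real \<Rightarrow> real" where
  "yang_factor N' b u t = 1 / yang_lambda N' b * exp (2 * yang_alpha N' * (u t - exp (u t)))"

text \<open>The metrics \<open>g\<close> and \<open>h\<close> are smooth on the whole projective line, and are determined by
  continuity by their restrictions to \<open>\<complex> - {0}\<close>, where \<open>t = ln \<bar>z\<bar>\<close>.\<close>

definition yang_pair :: "nat \<Rightarrow> real \<Rightarrow> (real \<Rightarrow> real) \<Rightarrow>
    (complex, (complex \<times> complex) set) tensor2 \<Rightarrow> (complex \<times> complex \<Rightarrow> real) \<Rightarrow> bool" where
  "yang_pair N' b u g h \<longleftrightarrow>
     riemannian_metric CP1 g \<and>
     (\<forall>(U, x) \<in> cylinder. \<forall>y \<in> U. \<forall>v w.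
        pullback CP1 cyl_to_CP1 g (U, x) y v w = cyl_tensor (yang_factor N' b u) (U, x) y v w) \<and>
     hermitian_metric_O (2 * N') h \<and>
     (\<forall>z. z \<noteq> 0 \<longrightarrow> norm_sq (higgs N') h z = exp (u (ln (cmod z))))"

text \<open>The limit metric \<open>exp (- 2 N' t)\<close>, as a function of \<open>z\<close>.\<close>

definition h_infty :: "nat \<Rightarrow> complex \<Rightarrow> real" where
  "h_infty N' z = exp (- (2 * N' * ln (cmod z)))"

end

theory Submission
  imports Defs "HOL-Complex_Analysis.Complex_Analysis"
begin

text \<open>For small \<open>b\<close> the solution starts close to the equilibrium \<open>u = 0\<close> of the differential
equation. Its right-hand side is bounded linearly in \<open>u\<close> with a constant that does not depend on
\<open>b \<le> 1\<close>, so a Gronwall estimate for \<open>u\<^sup>2 + u'\<^sup>2\<close> (lemma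
\<open>yang_solution_small\<close>) shows that \<open>u\<close> and \<open>u'\<close> tend to \<open>0\<close> uniformly on compact intervals, and
consequently that the conformal factor tends to \<open>2 N'\<close>.

Convergence of the higher derivatives needs no further estimate. The functions \<open>exp u - 1\<close>, \<open>u'\<close> and the
conformal factor generate a ring that is closed under differentiation, by the equation itself. Thus
derivatives of all orders are fixed polynomials in functions that converge locally uniformly (lemmas
\<open>generated_ring_smooth_limit\<close>, \<open>yang_smooth_limit\<close>). The metric \<open>g\<close>, the metric \<open>h\<close> and
the norm of the Higgs field, in cylindrical coordinates, all lie in this ring once
\<open>exp (- 2 N' t)\<close> is adjoined to it.

The global statements follow from one estimate. If the conformal factor is at least \<open>1\<close> for
\<open>\<bar>t\<bar> \<le> R\<close>, then every curve from the equator to a pole has length at least \<open>R\<close>, because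
\<open>t\<close> must vary by \<open>R\<close> before the curve leaves that region (lemma \<open>curve_length_to_pole\<close>).
As \<open>b\<close> tends to \<open>0\<close> this applies to every \<open>R\<close>. Hence the diameter tends to
infinity, and a metric ball about a point of the equator eventually contains no pole. The embedding of the
whole cylinder as the complement of the two poles, a diffeomorphism by lemma \<open>diffeo_cyl_to_CP1\<close>,
therefore realizes the pointed Cheeger-Gromov convergence.\<close>

section \<open>Iterated partial derivatives\<close>

lemma frechet_derivative_cong_open:
  assumes "open U" "y \<in> U" "\<And>y. y \<in> U \<Longrightarrow> f y = g y"
  shows "frechet_derivative f (at y) = frechet_derivative g (at y)"
proof -
  have "(f has_derivative D) (at y) \<longleftrightarrow> (g has_derivative D) (at y)" for D
    using has_derivative_transform_within_open[of f D y UNIV U g]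
      has_derivative_transform_within_open[of g D y UNIV U f] assms by auto
  then show ?thesis
    unfolding frechet_derivative_def by simp
qed

lemma partials_cong_open:
  assumes "open U" "\<And>y. y \<in> U \<Longrightarrow> f y = g y" "y \<in> U"
  shows "partials vs f y = partials vs g y"
  using assms(3)
proof (induction vs arbitrary: y)
  case (Cons v vs)
  then show ?case
    using frechet_derivative_cong_open[OF assms(1) Cons.prems Cons.IH] by simp
qed (use assms in auto)

lemma smooth_limit_cong_open:
  assumes "open U" "K \<subseteq> U"
    and "\<forall>\<^sub>F i in F. \<forall>y\<in>U. f i y = f' i y" and "\<And>y. y \<in> U \<Longrightarrow> l y = l' y"
    and "smooth_limit K f' l' F"
  shows "smooth_limit K f l F"
  unfolding smooth_limit_def
proof
  fix vs :: "'a list" assume vs: "vs \<in> lists Basis"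
  have "\<forall>\<^sub>F i in F. \<forall>y\<in>K. partials vs (f i) y = partials vs (f' i) y"
    using assms(3)
  proof eventually_elim
    case (elim i)
    show ?case
      using partials_cong_open[OF assms(1), of "f i" "f' i"] elim assms(2) by blast
  qed
  moreover have "\<forall>y\<in>K. partials vs l y = partials vs l' y"
    using partials_cong_open[OF assms(1), of l l'] assms(2,4) by blast
  ultimately show "uniform_limit K (\<lambda>i. partials vs (f i)) (partials vs l) F"
    using assms(5) vs unfolding smooth_limit_def
    by (subst uniform_limit_cong[where g="\<lambda>i. partials vs (f' i)" and i="partials vs l'"]) auto
qed

text \<open>The transition maps between the affine charts of the projective line and the cylinder are holomorphic up
to real linear identifications \<open>J\<close>, \<open>A\<close>. Each partial derivative in a direction \<open>v\<close> then
replaces \<open>F\<close> by \<open>A v\<close> times its complex derivative, so that smoothness is the infinite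
differentiability of holomorphic functions.\<close>

lemma smooth_on_holomorphic:
  fixes A :: "'e::euclidean_space \<Rightarrow> complex" and J :: "complex \<Rightarrow> 'f::real_normed_vector"
  assumes A: "bounded_linear A" and J: "bounded_linear J"
    and W: "open W" "F holomorphic_on W" and S: "open S" "\<And>y. y \<in> S \<Longrightarrow> A y \<in> W"
    and f: "\<And>y. y \<in> S \<Longrightarrow> f y = J (F (A y))"
  shows "smooth_on S f"
proof -
  define G where "G vs y = J ((\<Prod>v\<leftarrow>vs. A v) * (deriv ^^ length vs) F (A y))" for vs y
  have der: "(G vs has_derivative (\<lambda>v. G (v # vs) y)) (at y)" if "y \<in> S" for vs y
  proof -
    have "((deriv ^^ length vs) F has_field_derivative (deriv ^^ Suc (length vs)) F (A y)) (at (A y))"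
      using holomorphic_derivI[OF holomorphic_higher_deriv[OF W(2,1)] W(1)] S(2)[OF that] by simp
    then have "((deriv ^^ length vs) F has_derivative (*) ((deriv ^^ Suc (length vs)) F (A y))) (at (A y))"
      by (simp add: has_field_derivative_def)
    from has_derivative_compose[OF bounded_linear_imp_has_derivative[OF A] this]
    have "((\<lambda>y. (\<Prod>v\<leftarrow>vs. A v) * (deriv ^^ length vs) F (A y)) has_derivative
        (\<lambda>v. (\<Prod>v\<leftarrow>vs. A v) * ((deriv ^^ Suc (length vs)) F (A y) * A v))) (at y)"
      by (rule has_derivative_mult_right)
    from has_derivative_compose[OF this bounded_linear_imp_has_derivative[OF J]]
    show ?thesis
      unfolding G_def by (simp add: mult_ac)
  qed
  have eq: "partials vs f y = G vs y" if "y \<in> S" for vs y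
    using that
  proof (induction vs arbitrary: y)
    case (Cons v vs)
    have "frechet_derivative (partials vs f) (at y) = frechet_derivative (G vs) (at y)"
      by (rule frechet_derivative_cong_open[OF S(1) Cons.prems Cons.IH])
    also have "\<dots> = (\<lambda>v. G (v # vs) y)"
      using frechet_derivative_at[OF der[OF Cons.prems]] by simp
    finally show ?case by simp
  qed (simp add: G_def f)
  have "partials vs f differentiable (at y)" if "y \<in> S" for vs y
    using has_derivative_transform_within_open[OF der[OF that] S(1) that] eq
    unfolding differentiable_def by metis
  then show ?thesis
    unfolding smooth_on_def differentiable_on_def
    using differentiable_at_withinI by blast
qed

section \<open>Differential rings of convergent families\<close>

text \<open>A pair \<open>(f, l)\<close> stands for a family \<open>f i\<close> together with its prospective limit \<open>l\<close>.
If the derivatives of the generators are polynomials in the generators, then so are all higher derivatives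
of everything in the ring. Locally uniform convergence of the generators alone thus gives convergence of
derivatives of every order, with the correct limits because the limits are differentiated by the same
polynomials.\<close>

inductive_set generated_ring ::
    "(('i \<Rightarrow> real \<Rightarrow> real) \<times> (real \<Rightarrow> real)) set \<Rightarrow> (('i \<Rightarrow> real \<Rightarrow> real) \<times> (real \<Rightarrow> real)) set"
  for G where
  gen: "fl \<in> G \<Longrightarrow> fl \<in> generated_ring G"
| const: "(\<lambda>i t. c, \<lambda>t. c) \<in> generated_ring G"
| add: "(f, l) \<in> generated_ring G \<Longrightarrow> (f', l') \<in> generated_ring G \<Longrightarrow>
    (\<lambda>i t. f i t + f' i t, \<lambda>t. l t + l' t) \<in> generated_ring G"
| mult: "(f, l) \<in> generated_ring G \<Longrightarrow> (f', l') \<in> generated_ring G \<Longrightarrow>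
    (\<lambda>i t. f i t * f' i t, \<lambda>t. l t * l' t) \<in> generated_ring G"

definition derivation_pair where
  "derivation_pair F fl fl' \<longleftrightarrow>
     (\<forall>\<^sub>F i in F. \<forall>t. (fst fl i has_real_derivative fst fl' i t) (at t)) \<and>
     (\<forall>t. (snd fl has_real_derivative snd fl' t) (at t))"

lemma generated_ring_derivation:
  assumes gen: "\<And>fl. fl \<in> G \<Longrightarrow> \<exists>fl' \<in> generated_ring G. derivation_pair F fl fl'"
    and "fl \<in> generated_ring G"
  shows "\<exists>fl' \<in> generated_ring G. derivation_pair F fl fl'"
  using assms(2)
proof (induction rule: generated_ring.induct)
  case (gen fl)
  then show ?case by (rule assms(1))
next
  case (const c)
  show ?case
    by (rule bexI[OF _ generated_ring.const[of 0]]) (simp add: derivation_pair_def)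
next
  case (add f l f' l')
  then obtain d e d' e' where de: "(d, e) \<in> generated_ring G" "(d', e') \<in> generated_ring G"
    and D: "derivation_pair F (f, l) (d, e)" "derivation_pair F (f', l') (d', e')"
    by auto
  have "derivation_pair F (\<lambda>i t. f i t + f' i t, \<lambda>t. l t + l' t) (\<lambda>i t. d i t + d' i t, \<lambda>t. e t + e' t)"
    using D eventually_elim2[of "\<lambda>i. \<forall>t. (f i has_real_derivative d i t) (at t)" F
        "\<lambda>i. \<forall>t. (f' i has_real_derivative d' i t) (at t)"]
    unfolding derivation_pair_def by (simp add: DERIV_add)
  then show ?case
    using generated_ring.add[OF de] by blast
next
  case (mult f l f' l')
  then obtain d e d' e' where de: "(d, e) \<in> generated_ring G" "(d', e') \<in> generated_ring G"
    and D: "derivation_pair F (f, l) (d, e)" "derivation_pair F (f', l') (d', e')"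
    by auto
  have "derivation_pair F (\<lambda>i t. f i t * f' i t, \<lambda>t. l t * l' t)
      (\<lambda>i t. d i t * f' i t + d' i t * f i t, \<lambda>t. e t * l' t + e' t * l t)"
    using D eventually_elim2[of "\<lambda>i. \<forall>t. (f i has_real_derivative d i t) (at t)" F
        "\<lambda>i. \<forall>t. (f' i has_real_derivative d' i t) (at t)"]
    unfolding derivation_pair_def by (simp add: DERIV_mult)
  moreover have "(\<lambda>i t. d i t * f' i t + d' i t * f i t, \<lambda>t. e t * l' t + e' t * l t) \<in> generated_ring G"
    by (intro generated_ring.add generated_ring.mult de mult.hyps)
  ultimately show ?case by blast
qed

text \<open>Products of uniformly convergent families converge uniformly only where the limits are bounded; continuity
of the limits on the compact set \<open>K\<close> provides this.\<close>

lemma generated_ring_uniform_limit: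
  assumes gen: "\<And>fl. fl \<in> G \<Longrightarrow> uniform_limit K (fst fl) (snd fl) F \<and> continuous_on K (snd fl)"
    and K: "compact K" and "fl \<in> generated_ring G"
  shows "uniform_limit K (fst fl) (snd fl) F \<and> continuous_on K (snd fl)"
  using assms(3)
proof (induction rule: generated_ring.induct)
  case (gen fl)
  then show ?case by (rule assms(1))
next
  case (mult f l f' l')
  then have "bounded (l ` K)" "bounded (l' ` K)"
    using K by (auto intro!: compact_imp_bounded compact_continuous_image)
  with mult show ?case
    by (auto intro!: uniform_lim_mult continuous_on_mult)
qed (auto intro!: uniform_limit_intros continuous_intros)

text \<open>Transfer to functions of \<open>(t, \<theta>)\<close> that depend on \<open>t\<close> only: a partial derivative in the
direction \<open>v\<close> is the derivation of the ring multiplied by the constant \<open>fst v\<close>.\<close>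

lemma generated_ring_smooth_limit:
  assumes der: "\<And>fl. fl \<in> G \<Longrightarrow> \<exists>fl' \<in> generated_ring G. derivation_pair F fl fl'"
    and lim: "\<And>fl K. fl \<in> G \<Longrightarrow> compact K \<Longrightarrow> uniform_limit K (fst fl) (snd fl) F"
    and fl: "(f, l) \<in> generated_ring G" and K: "compact K"
  shows "smooth_limit K (\<lambda>i y :: real \<times> real. f i (fst y)) (\<lambda>y. l (fst y)) F"
  unfolding smooth_limit_def
proof
  fix vs :: "(real \<times> real) list"
  have "\<exists>(f', l') \<in> generated_ring G.
      (\<forall>\<^sub>F i in F. partials vs (\<lambda>y. f i (fst y)) = (\<lambda>y. f' i (fst y))) \<and>
      partials vs (\<lambda>y. l (fst y)) = (\<lambda>y. l' (fst y))"
  proof (induction vs)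
    case Nil
    show ?case by (rule bexI[OF _ fl]) simp
  next
    case (Cons v vs)
    then obtain f' l' where fl': "(f', l') \<in> generated_ring G"
      and f': "\<forall>\<^sub>F i in F. partials vs (\<lambda>y. f i (fst y)) = (\<lambda>y. f' i (fst y))"
      and l': "partials vs (\<lambda>y. l (fst y)) = (\<lambda>y. l' (fst y))"
      by auto
    obtain d e where de: "(d, e) \<in> generated_ring G" and D: "derivation_pair F (f', l') (d, e)"
      using generated_ring_derivation[OF der fl'] by auto
    have frech: "frechet_derivative (\<lambda>y :: real \<times> real. h (fst y)) (at y) v = fst v * h' (fst y)"
      if "\<And>t. (h has_real_derivative h' t) (at t)" for h h' :: "real \<Rightarrow> real" and y
    proof -
      have "((\<lambda>y. h (fst y)) has_derivative (\<lambda>v. h' (fst y) * fst v)) (at y)"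
        using has_derivative_compose[OF has_derivative_fst[OF has_derivative_ident]
            that[unfolded has_field_derivative_def]] .
      from frechet_derivative_at[OF this] show ?thesis
        by (metis mult.commute)
    qed
    have "\<forall>\<^sub>F i in F. partials (v # vs) (\<lambda>y. f i (fst y)) = (\<lambda>y. fst v * d i (fst y))"
      using f' D[unfolded derivation_pair_def, THEN conjunct1]
      by eventually_elim (auto intro!: ext frech)
    moreover have "partials (v # vs) (\<lambda>y. l (fst y)) = (\<lambda>y. fst v * e (fst y))"
      using D l' by (auto intro!: ext frech simp: derivation_pair_def)
    ultimately show ?case
      by (intro bexI[OF _ generated_ring.mult[OF generated_ring.const[of "fst v"] de]]) auto
  qed
  then obtain f' l' where fl': "(f', l') \<in> generated_ring G"
    and f': "\<forall>\<^sub>F i in F. partials vs (\<lambda>y. f i (fst y)) = (\<lambda>y. f' i (fst y))"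
    and l': "partials vs (\<lambda>y. l (fst y)) = (\<lambda>y. l' (fst y))"
    by auto
  have K': "compact (fst ` K)"
    using K by (intro compact_continuous_image continuous_intros)
  have cont: "continuous_on S (snd fl)" if "fl \<in> G" for fl S
    using der[OF that] unfolding derivation_pair_def
    by (meson DERIV_isCont continuous_at_imp_continuous_on)
  have "uniform_limit (fst ` K) f' l' F"
    using generated_ring_uniform_limit[OF _ K' fl'] lim[OF _ K'] cont by simp
  then have "uniform_limit K (\<lambda>i y. f' i (fst y)) (\<lambda>y. l' (fst y)) F"
    unfolding uniform_limit_iff by auto
  then show "uniform_limit K (\<lambda>i. partials vs (\<lambda>y. f i (fst y))) (partials vs (\<lambda>y. l (fst y))) F"
    using f' l' by (subst uniform_limit_cong[where g="\<lambda>i y. f' i (fst y)" and i="\<lambda>y. l' (fst y)"])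
      (auto elim!: eventually_mono)
qed

section \<open>Yang's solutions for small initial height\<close>

lemma yang_factor_eq:
  assumes "N' \<ge> 1"
  shows "yang_factor N' b u t = 2 * N' * exp ((b + exp (- b) + (u t - exp (u t))) / N')"
  using assms
  by (simp add: yang_factor_def yang_lambda_def yang_alpha_def exp_add[symmetric] add_divide_distrib[symmetric])

text \<open>The right-hand side of the differential equation vanishes at \<open>x = 0\<close> and is bounded linearly on the whole
line, the factor \<open>exp (- exp x / n)\<close> absorbing the growth for \<open>x > 0\<close>. Being
global, the bound controls the solution before anything is known about its range or sign.\<close>

lemma force_bound:
  fixes n x :: real
  assumes n: "n \<ge> 1"
  shows "\<bar>exp ((x - exp x) / n) * (exp x - 1)\<bar> \<le> 2 * n\<^sup>2 * \<bar>x\<bar>"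
proof (cases "x \<ge> 0")
  case True
  have "1 - x \<le> exp (- x)"
    using exp_ge_add_one_self[of "- x"] by simp
  then have "exp x * (1 - x) \<le> exp x * exp (- x)"
    by (intro mult_left_mono) auto
  then have 1: "exp x - 1 \<le> x * exp x"
    by (simp add: exp_minus algebra_simps)
  have "exp ((x - exp x) / n) \<le> exp (x - exp x / n)"
    using n True by (simp add: diff_divide_distrib divide_le_eq mult_left_le mult_le_cancel_left1)
  then have "exp ((x - exp x) / n) * (exp x - 1) \<le> exp (x - exp x / n) * (x * exp x)"
    using 1 True by (intro mult_mono) auto
  also have "\<dots> = x * ((exp x)\<^sup>2 * exp (- (exp x / n)))"
    by (simp add: exp_diff exp_minus field_simps power2_eq_square)
  also have "(exp x)\<^sup>2 * exp (- (exp x / n)) \<le> 2 * n\<^sup>2"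
  proof -
    have "0 \<le> exp x / n"
      using n by simp
    then have "(exp x / n)\<^sup>2 / 2 \<le> exp (exp x / n)"
      using exp_lower_Taylor_quadratic[of "exp x / n"] by linarith
    then show ?thesis
      using n by (simp add: exp_minus field_simps power_divide)
  qed
  then have "x * ((exp x)\<^sup>2 * exp (- (exp x / n))) \<le> x * (2 * n\<^sup>2)"
    using True by (rule mult_left_mono)
  finally show ?thesis
    using True by (simp add: abs_mult mult_ac)
next
  case False
  have "x - exp x \<le> 0"
    using exp_ge_add_one_self[of x] by linarith
  then have "exp ((x - exp x) / n) \<le> 1"
    using n by (simp add: divide_nonpos_pos)
  moreover have "\<bar>exp x - 1\<bar> \<le> \<bar>x\<bar>"
    using False exp_ge_add_one_self[of x] exp_le_one_iff[of x] by linarith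
  ultimately have "exp ((x - exp x) / n) * \<bar>exp x - 1\<bar> \<le> 1 * \<bar>x\<bar>"
    by (intro mult_mono) auto
  moreover have "1 * \<bar>x\<bar> \<le> 2 * n\<^sup>2 * \<bar>x\<bar>"
    using one_le_power[OF n, of 2] by (intro mult_right_mono) linarith+
  ultimately show ?thesis
    by (simp add: abs_mult)
qed

lemma gronwall_two_sided:
  fixes E E' :: "real \<Rightarrow> real"
  assumes der: "\<And>t. (E has_real_derivative E' t) (at t)" and bd: "\<And>t. \<bar>E' t\<bar> \<le> C * E t"
  shows "E t \<le> E 0 * exp (C * \<bar>t\<bar>)"
proof -
  have fwd: "h t \<le> h 0 * exp (C * t)"
    if "t \<ge> 0" "\<And>t. (h has_real_derivative h' t) (at t)" "\<And>t. h' t \<le> C * h t" for h h' t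
  proof -
    have "h t * exp (- C * t) \<le> h 0 * exp (- C * 0)"
    proof (rule DERIV_nonpos_imp_nonincreasing[OF that(1)])
      fix x
      have "((\<lambda>t. h t * exp (- C * t)) has_real_derivative (h' x - C * h x) * exp (- C * x)) (at x)"
        by (auto intro!: derivative_eq_intros that simp: algebra_simps)
      moreover have "(h' x - C * h x) * exp (- C * x) \<le> 0"
        using that(3)[of x] by (simp add: mult_nonpos_nonneg)
      ultimately show "\<exists>y. ((\<lambda>t. h t * exp (- C * t)) has_real_derivative y) (at x) \<and> y \<le> 0"
        by blast
    qed
    then show ?thesis
      by (simp add: exp_minus field_simps)
  qed
  show ?thesis
  proof (cases "t \<ge> 0")
    case True
    then show ?thesis
      using fwd[OF True der] bd by (simp add: abs_le_iff)
  next
    case False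
    have "((\<lambda>t. E (- t)) has_real_derivative - E' (- s)) (at s)" for s
      using DERIV_chain2[OF der DERIV_minus[OF DERIV_ident]] by simp
    from fwd[OF _ this, of "- t"] show ?thesis
      using False bd by (simp add: abs_le_iff)
  qed
qed

text \<open>The energy \<open>u\<^sup>2 + u'\<^sup>2\<close> equals \<open>b\<^sup>2\<close> at time \<open>0\<close>, and by the
linear bound on the force its growth rate is bounded independently of \<open>b \<le> 1\<close>: for such
\<open>b\<close> the constant \<open>exp ((b + exp (- b)) / N')\<close> in the force is at most
\<open>exp 2\<close>.\<close>

lemma yang_solution_small:
  assumes N': "N' \<ge> 1" and b: "0 < b" "b \<le> 1" and u: "yang_solution N' b u"
  shows "(u t)\<^sup>2 + (deriv u t)\<^sup>2 \<le> b\<^sup>2 * exp ((4 * N' ^ 3 * exp 2 + 1) * \<bar>t\<bar>)"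
proof -
  define L where "L = 4 * real N' ^ 3 * exp 2"
  define q where "q t = yang_factor N' b u t * (exp (u t) - 1)" for t
  have init: "u 0 = - b" "deriv u 0 = 0"
    and u': "(u has_real_derivative deriv u t) (at t)"
    and u'': "(deriv u has_real_derivative q t) (at t)" for t
    using u unfolding yang_solution_def q_def yang_factor_def
    by (auto simp: DERIV_deriv_iff_real_differentiable)
  have q: "\<bar>q t\<bar> \<le> L * \<bar>u t\<bar>" for t
  proof -
    have "(b + exp (- b)) / N' \<le> 2 / 1"
      using b N' by (intro frac_le) (auto intro!: add_mono[of b 1 "exp (- b)" 1, simplified])
    then have le: "exp ((b + exp (- b)) / N') \<le> exp 2"
      by simp
    have "q t = 2 * N' * exp ((b + exp (- b)) / N') * (exp ((u t - exp (u t)) / N') * (exp (u t) - 1))"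
      unfolding q_def yang_factor_eq[OF N'] by (simp add: add_divide_distrib exp_add)
    then have "\<bar>q t\<bar> = 2 * N' * exp ((b + exp (- b)) / N') * \<bar>exp ((u t - exp (u t)) / N') * (exp (u t) - 1)\<bar>"
      by (simp add: abs_mult)
    also have "\<dots> \<le> 2 * N' * exp 2 * (2 * (real N')\<^sup>2 * \<bar>u t\<bar>)"
      using le N' force_bound[of "real N'" "u t"] by (intro mult_mono) auto
    finally show ?thesis
      by (simp add: L_def power2_eq_square power3_eq_cube mult_ac)
  qed
  have L: "L \<ge> 0"
    by (simp add: L_def)
  have "(u t)\<^sup>2 + (deriv u t)\<^sup>2 \<le> ((u 0)\<^sup>2 + (deriv u 0)\<^sup>2) * exp ((L + 1) * \<bar>t\<bar>)"
  proof (rule gronwall_two_sided)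
    fix t
    show "((\<lambda>t. (u t)\<^sup>2 + (deriv u t)\<^sup>2) has_real_derivative 2 * deriv u t * (u t + q t)) (at t)"
      by (auto intro!: derivative_eq_intros u' u'' simp: algebra_simps)
    have "\<bar>u t + q t\<bar> \<le> (L + 1) * \<bar>u t\<bar>"
      using q[of t] by (simp add: algebra_simps abs_if split: if_splits)
    then have "\<bar>2 * deriv u t * (u t + q t)\<bar> \<le> (2 * \<bar>deriv u t\<bar>) * ((L + 1) * \<bar>u t\<bar>)"
      by (simp add: abs_mult mult_left_mono)
    also have "\<dots> = (L + 1) * (2 * \<bar>u t\<bar> * \<bar>deriv u t\<bar>)"
      by (simp add: mult_ac)
    also have "\<dots> \<le> (L + 1) * ((u t)\<^sup>2 + (deriv u t)\<^sup>2)"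
      using L sum_squares_bound[of "\<bar>u t\<bar>" "\<bar>deriv u t\<bar>"] by (intro mult_left_mono) auto
    finally show "\<bar>2 * deriv u t * (u t + q t)\<bar> \<le> (L + 1) * ((u t)\<^sup>2 + (deriv u t)\<^sup>2)" .
  qed
  then show ?thesis
    by (simp add: init L_def)
qed

lemma yang_uniform_limits:
  assumes N': "N' \<ge> 1" and u: "\<And>b. b > 0 \<Longrightarrow> yang_solution N' b (u b)" and K: "compact K"
  shows "uniform_limit K u (\<lambda>t. 0) (at_right 0)"
    and "uniform_limit K (\<lambda>b. deriv (u b)) (\<lambda>t. 0) (at_right 0)"
proof -
  define C where "C = 4 * real N' ^ 3 * exp 2 + 1"
  obtain R where R: "\<And>t. t \<in> K \<Longrightarrow> \<bar>t\<bar> \<le> R"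
    using compact_imp_bounded[OF K] by (auto simp: bounded_iff)
  have C: "C \<ge> 0"
    by (simp add: C_def)
  have "\<bar>u b t\<bar> \<le> b * exp (C * R / 2) \<and> \<bar>deriv (u b) t\<bar> \<le> b * exp (C * R / 2)"
    if b: "0 < b" "b < 1" and t: "t \<in> K" for b t
  proof -
    have "(u b t)\<^sup>2 + (deriv (u b) t)\<^sup>2 \<le> b\<^sup>2 * exp (C * \<bar>t\<bar>)"
      using yang_solution_small[OF N' b(1) _ u] b by (simp add: C_def)
    also have "\<dots> \<le> b\<^sup>2 * exp (C * R)"
      using R[OF t] C by (intro mult_left_mono) (auto intro: mult_left_mono)
    also have "\<dots> = (b * exp (C * R / 2))\<^sup>2"
      by (simp add: power_mult_distrib exp_double[symmetric])
    finally have *: "(u b t)\<^sup>2 + (deriv (u b) t)\<^sup>2 \<le> (b * exp (C * R / 2))\<^sup>2" .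
    have "\<bar>u b t\<bar>\<^sup>2 \<le> (b * exp (C * R / 2))\<^sup>2" "\<bar>deriv (u b) t\<bar>\<^sup>2 \<le> (b * exp (C * R / 2))\<^sup>2"
      using * zero_le_power2[of "u b t"] zero_le_power2[of "deriv (u b) t"] unfolding power2_abs
      by linarith+
    then show ?thesis
      using b by (meson power2_le_imp_le mult_nonneg_nonneg less_imp_le exp_ge_zero)
  qed
  moreover have "\<forall>\<^sub>F b in at_right 0. 0 < b \<and> b < 1 \<and> b * exp (C * R / 2) < e" if "e > 0" for e :: real
  proof -
    have "\<forall>\<^sub>F b in at_right 0. b \<in> {0 <..< min 1 (e / exp (C * R / 2))}"
      using that by (intro eventually_at_right_real) simp
    then show ?thesis
      by eventually_elim (simp add: pos_less_divide_eq)
  qed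
  ultimately have "\<forall>\<^sub>F b in at_right 0. \<forall>t\<in>K. \<bar>u b t\<bar> < e \<and> \<bar>deriv (u b) t\<bar> < e" if "e > 0" for e
    using that by (smt (verit) eventually_mono)
  note small = this
  show "uniform_limit K u (\<lambda>t. 0) (at_right 0)"
    "uniform_limit K (\<lambda>b. deriv (u b)) (\<lambda>t. 0) (at_right 0)"
    unfolding uniform_limit_iff dist_real_def diff_0_right
    by (intro allI impI, rule eventually_mono[OF small]; blast)+
qed

lemma uniform_limit_isCont_const:
  assumes f: "uniform_limit K f (\<lambda>t. c) F" and h: "isCont h c"
  shows "uniform_limit K (\<lambda>i t. h (f i t)) (\<lambda>t. h c) F"
  unfolding uniform_limit_iff
proof (intro allI impI)
  fix e :: real assume "e > 0"
  then obtain d where d: "d > 0" "\<And>x. dist x c < d \<Longrightarrow> dist (h x) (h c) < e"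
    using h unfolding continuous_at_eps_delta by blast
  have "\<forall>\<^sub>F i in F. \<forall>t\<in>K. dist (f i t) c < d"
    using f d(1) unfolding uniform_limit_iff by blast
  then show "\<forall>\<^sub>F i in F. \<forall>t\<in>K. dist (h (f i t)) (h c) < e"
    by eventually_elim (auto intro: d(2))
qed

lemma yang_factor_uniform_limit:
  assumes N': "N' \<ge> 1" and u: "\<And>b. b > 0 \<Longrightarrow> yang_solution N' b (u b)" and K: "compact K"
  shows "uniform_limit K (\<lambda>b. yang_factor N' b (u b)) (\<lambda>t. 2 * N') (at_right 0)"
proof -
  have 1: "uniform_limit K (\<lambda>b t. u b t - exp (u b t)) (\<lambda>t. 0 - exp 0) (at_right 0)"
    using uniform_limit_isCont_const[OF yang_uniform_limits(1)[OF N' u K], of "\<lambda>x. x - exp x"]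
    by (simp add: continuous_intros)
  have "((\<lambda>b :: real. b + exp (- b)) \<longlongrightarrow> 0 + exp (- 0)) (at_right 0)"
    by (intro tendsto_intros)
  then have 2: "uniform_limit K (\<lambda>b t. b + exp (- b)) (\<lambda>t. 0 + exp (- 0 :: real)) (at_right 0)"
    unfolding uniform_limit_iff by (auto dest: tendstoD elim!: eventually_mono)
  have "uniform_limit K (\<lambda>b t. b + exp (- b) + (u b t - exp (u b t))) (\<lambda>t. 0) (at_right 0)"
    using uniform_limit_add[OF 2 1] by simp
  from uniform_limit_isCont_const[OF this, of "\<lambda>x. 2 * N' * exp (x / N')"]
  show ?thesis
    using N' yang_factor_eq[OF N', abs_def] by (simp add: continuous_intros)
qed

text \<open>The derivatives of \<open>x = exp u - 1\<close>, \<open>v = u'\<close> and the conformal factor \<open>r\<close> are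
\<open>(x + 1) v\<close>, \<open>r x\<close> and \<open>- (1 / N') r x v\<close>, so these three functions are
closed under differentiation. The last generator is the quotient of the metric on the line bundle and
\<open>exp u\<close>.\<close>

definition yang_generators ::
    "nat \<Rightarrow> (real \<Rightarrow> real \<Rightarrow> real) \<Rightarrow> ((real \<Rightarrow> real \<Rightarrow> real) \<times> (real \<Rightarrow> real)) set" where
  "yang_generators N' u =
     {(\<lambda>b t. exp (u b t) - 1, \<lambda>t. 0), (\<lambda>b. deriv (u b), \<lambda>t. 0),
      (\<lambda>b. yang_factor N' b (u b), \<lambda>t. 2 * N'),
      (\<lambda>b t. exp (- (2 * N' * t)), \<lambda>t. exp (- (2 * N' * t)))}"

lemma yang_smooth_limit:
  fixes K :: "(real \<times> real) set"
  assumes N': "N' \<ge> 1" and u: "\<And>b. b > 0 \<Longrightarrow> yang_solution N' b (u b)"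
    and fl: "(f, l) \<in> generated_ring (yang_generators N' u)" and K: "compact K"
  shows "smooth_limit K (\<lambda>b y. f b (fst y)) (\<lambda>y. l (fst y)) (at_right 0)"
proof (rule generated_ring_smooth_limit[OF _ _ fl K])
  fix fl and K :: "real set" assume "fl \<in> yang_generators N' u" "compact K"
  moreover have "uniform_limit K (\<lambda>b t. exp (u b t) - 1) (\<lambda>t. 0) (at_right 0)" if "compact K"
    using uniform_limit_isCont_const[OF yang_uniform_limits(1)[OF N' u that], of "\<lambda>x. exp x - 1"]
    by (simp add: continuous_intros)
  ultimately show "uniform_limit K (fst fl) (snd fl) (at_right 0)"
    using yang_uniform_limits(2)[OF N' u] yang_factor_uniform_limit[OF N' u]
    unfolding yang_generators_def by (auto intro: uniform_limit_const)
next
  fix fl assume fl: "fl \<in> yang_generators N' u"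
  let ?R = "generated_ring (yang_generators N' u)"
  have x: "(\<lambda>b t. exp (u b t) - 1, \<lambda>t. 0) \<in> ?R" and v: "(\<lambda>b. deriv (u b), \<lambda>t. 0) \<in> ?R"
    and r: "(\<lambda>b. yang_factor N' b (u b), \<lambda>t. real (2 * N')) \<in> ?R"
    and e: "(\<lambda>b t. exp (- (2 * N' * t)), \<lambda>t. exp (- (2 * N' * t))) \<in> ?R"
    by (auto intro!: generated_ring.gen simp: yang_generators_def)
  note c = generated_ring.const
  have I: "\<exists>fl'\<in>?R. derivation_pair (at_right 0) fl fl'"
    if "fl' \<in> ?R" "derivation_pair (at_right 0) fl fl'" for fl fl'
    using that by blast
  have u': "(u b has_real_derivative deriv (u b) t) (at t)"
    and u'': "(deriv (u b) has_real_derivative yang_factor N' b (u b) t * (exp (u b t) - 1)) (at t)"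
    if "b > 0" for b t
    using u[OF that] unfolding yang_solution_def yang_factor_def
    by (auto simp: DERIV_deriv_iff_real_differentiable)
  have pos: "\<forall>\<^sub>F b :: real in at_right 0. b > 0"
    by (simp add: eventually_at_right_less)
  have "derivation_pair (at_right 0) (\<lambda>b t. exp (u b t) - 1, \<lambda>t. 0)
      (\<lambda>b t. deriv (u b) t * ((exp (u b t) - 1) + 1), \<lambda>t. 0 * (0 + 1))"
    unfolding derivation_pair_def using pos
    by (auto elim!: eventually_mono intro!: derivative_eq_intros u')
  note dx = I[OF _ this, OF generated_ring.mult[OF v generated_ring.add[OF x c[of 1]]]]
  have "derivation_pair (at_right 0) (\<lambda>b. deriv (u b), \<lambda>t. 0)
      (\<lambda>b t. yang_factor N' b (u b) t * (exp (u b t) - 1), \<lambda>t. real (2 * N') * 0)"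
    unfolding derivation_pair_def using pos
    by (auto elim!: eventually_mono intro!: u'')
  note dv = I[OF _ this, OF generated_ring.mult[OF r x]]
  have "derivation_pair (at_right 0) (\<lambda>b. yang_factor N' b (u b), \<lambda>t. real (2 * N'))
      (\<lambda>b t. - (1 / N') * (yang_factor N' b (u b) t * ((exp (u b t) - 1) * deriv (u b) t)),
       \<lambda>t. - (1 / N') * (real (2 * N') * (0 * 0)))"
    unfolding derivation_pair_def yang_factor_eq[OF N', abs_def] using pos N'
    by (auto elim!: eventually_mono intro!: derivative_eq_intros u' simp: field_simps)
  note dr = I[OF _ this, OF generated_ring.mult[OF c[of "- (1 / N')"] generated_ring.mult[OF r generated_ring.mult[OF x v]]]]
  have "derivation_pair (at_right 0) (\<lambda>b t. exp (- (2 * N' * t)), \<lambda>t. exp (- (2 * N' * t)))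
      (\<lambda>b t. - (2 * N') * exp (- (2 * N' * t)), \<lambda>t. - (2 * N') * exp (- (2 * N' * t)))"
    unfolding derivation_pair_def
    by (auto intro!: always_eventually derivative_eq_intros)
  note de = I[OF _ this, OF generated_ring.mult[OF c[of "- (2 * N')"] e]]
  show "\<exists>fl'\<in>?R. derivation_pair (at_right 0) fl fl'"
    using fl dx dv dr de unfolding yang_generators_def by auto
qed

section \<open>Flatness of the limit metric on the line bundle\<close>

lemma has_derivative_ln_cmod:
  assumes "z \<noteq> 0"
  shows "((\<lambda>z. ln (cmod z)) has_derivative (\<lambda>v. Re (v / z))) (at z)"
proof -
  have "((\<lambda>z. ln (cmod z)) has_derivative (\<lambda>v. (v \<bullet> sgn z) / cmod z)) (at z)"
    using has_derivative_ln[OF _ has_derivative_norm[OF assms]] assms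
    by (simp add: divide_inverse mult_ac inner_commute)
  moreover have "(v \<bullet> sgn z) / cmod z = Re (v / z)" for v
  proof -
    have "(Re z)\<^sup>2 + (Im z)\<^sup>2 = cmod z * cmod z"
      by (metis cmod_power2 power2_eq_square)
    then show ?thesis
      by (simp add: sgn_div_norm inner_complex_def Re_divide add_divide_distrib divide_inverse
          distrib_left mult_ac)
  qed
  ultimately show ?thesis by simp
qed

text \<open>The logarithm of the limit metric is a multiple of \<open>ln \<bar>z\<bar>\<close>, whose antiholomorphic derivative
is antiholomorphic, namely a multiple of \<open>cnj (1 / z)\<close>.\<close>

lemma chern_curvature_h_infty:
  assumes z: "z \<noteq> 0"
  shows "chern_curvature (h_infty N') z v w = 0"
proof -
  have ln_der: "((\<lambda>z. complex_of_real (ln (h_infty N' z))) has_derivative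
      (\<lambda>v. complex_of_real (- (2 * N' * Re (v / z))))) (at z)" if "z \<noteq> 0" for z
  proof -
    have "((\<lambda>z. complex_of_real (- (2 * N' * ln (cmod z)))) has_derivative
        (\<lambda>v. complex_of_real (- (2 * N' * Re (v / z))))) (at z)"
      by (intro has_derivative_of_real has_derivative_minus has_derivative_mult_right
          has_derivative_ln_cmod that)
    then show ?thesis
      unfolding h_infty_def by simp
  qed
  have bar: "wirtinger_bar (\<lambda>z. complex_of_real (ln (h_infty N' z))) z = - N' * cnj (1 / z)" if "z \<noteq> 0" for z
  proof -
    define q where "q = 1 / z"
    have "v / z = v * q" for v
      by (simp add: q_def)
    then show ?thesis
      unfolding wirtinger_bar_def frechet_derivative_at[OF ln_der[OF that], symmetric] q_def[symmetric]
      by (simp add: complex_eq_iff)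
  qed
  have "((\<lambda>z. - N' * cnj (1 / z)) has_derivative (\<lambda>v. N' * cnj (v / z\<^sup>2))) (at z)"
    using z by (auto intro!: derivative_eq_intros simp: power2_eq_square field_simps)
  then have "(wirtinger_bar (\<lambda>z. complex_of_real (ln (h_infty N' z))) has_derivative
      (\<lambda>v. N' * cnj (v / z\<^sup>2))) (at z)"
    by (rule has_derivative_transform_within_open[of _ _ _ _ "- {0}"]) (use z bar in auto)
  then show ?thesis
    unfolding chern_curvature_def wirtinger_def
    using z by (simp add: frechet_derivative_at[symmetric]) (simp add: field_simps)
qed

section \<open>The cylinder as an open submanifold of the projective line\<close>

lemma proj_eq_iff:
  assumes "(z0, z1) \<noteq> 0" "(w0, w1) \<noteq> 0"
  shows "proj (z0, z1) = proj (w0, w1) \<longleftrightarrow> z0 * w1 = z1 * w0"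
proof
  assume "proj (z0, z1) = proj (w0, w1)"
  moreover have "(z0, z1) \<in> proj (z0, z1)"
    unfolding proj_def by (auto intro: exI[of _ 1])
  ultimately show "z0 * w1 = z1 * w0"
    unfolding proj_def by auto
next
  have sub: "proj (a0, a1) \<subseteq> proj (b0, b1)"
    if eq: "a0 * b1 = a1 * b0" and b: "(b0, b1) \<noteq> 0" for a0 a1 b0 b1 :: complex
  proof -
    have "\<exists>d. a0 = d * b0 \<and> a1 = d * b1"
    proof (cases "b0 = 0")
      case True
      then show ?thesis
        using eq b by (intro exI[of _ "a1 / b1"]) (auto simp: zero_prod_def)
    next
      case False
      then show ?thesis
        using eq by (intro exI[of _ "a0 / b0"]) (auto simp: field_simps)
    qed
    then obtain d where d: "a0 = d * b0" "a1 = d * b1"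
      by blast
    show ?thesis
      unfolding proj_def d by (auto simp flip: mult.assoc)
  qed
  assume "z0 * w1 = z1 * w0"
  then show "proj (z0, z1) = proj (w0, w1)"
    using sub[of z0 w1 z1 w0] sub[of w0 z1 w1 z0] assms by (auto simp: mult.commute)
qed

lemma proj_affine_eq_iff [simp]:
  "proj (1, z) = proj (1, z') \<longleftrightarrow> z = z'"
  "proj (w, 1) = proj (w', 1) \<longleftrightarrow> w = w'"
  "proj (1, z) = proj (w, 1) \<longleftrightarrow> z * w = 1"
  "proj (w, 1) = proj (1, z) \<longleftrightarrow> z * w = 1"
  by (auto simp: proj_eq_iff zero_prod_def mult.commute)

lemma chart_overlap [simp]:
  "proj (w, 1) \<in> (\<lambda>z. proj (1, z)) ` (- {0}) \<longleftrightarrow> w \<noteq> 0"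
  "proj (1, z) \<in> range (\<lambda>w. proj (w, 1)) \<longleftrightarrow> z \<noteq> 0"
proof -
  show "proj (w, 1) \<in> (\<lambda>z. proj (1, z)) ` (- {0}) \<longleftrightarrow> w \<noteq> 0"
    by (cases "w = 0") (auto simp: image_iff intro!: bexI[of _ "1 / w"])
  show "proj (1, z) \<in> range (\<lambda>w. proj (w, 1)) \<longleftrightarrow> z \<noteq> 0"
    by (cases "z = 0") (auto simp: image_iff intro!: exI[of _ "1 / z"])
qed

lemma inv_chart_0 [simp]: "inv_into UNIV (\<lambda>z. proj (1, z)) (proj (1, z)) = z"
  by (rule inv_into_f_eq) (auto intro: injI)

lemma inv_chart_1 [simp]:
  "z \<noteq> 0 \<Longrightarrow> inv_into UNIV (\<lambda>w. proj (w, 1)) (proj (1, z)) = 1 / z"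
  by (rule inv_into_f_eq) (auto intro: injI simp: proj_eq_iff zero_prod_def)

lemma cyl_to_C_eq_exp: "cyl_to_C (t, cis \<theta>) = exp (Complex t \<theta>)"
  by (simp add: cyl_to_C_def exp_eq_polar)

lemma carrier_cylinder: "carrier_of cylinder = UNIV \<times> sphere 0 1"
proof -
  define U where "U a = {(t :: real, \<theta>). a < \<theta> \<and> \<theta> < a + 2 * pi}" for a
  define x where "x = (\<lambda>(t :: real, \<theta>). (t, cis \<theta>))"
  have eq: "carrier_of cylinder = (\<Union>a. x ` U a)"
    by (auto simp: carrier_of_def cylinder_def U_def[symmetric] x_def[symmetric])
  have "p \<in> carrier_of cylinder \<longleftrightarrow> cmod (snd p) = 1" for p
  proof
    assume "p \<in> carrier_of cylinder"
    then obtain y where "p = x y"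
      unfolding eq by blast
    then show "cmod (snd p) = 1"
      by (simp add: x_def case_prod_beta)
  next
    assume *: "cmod (snd p) = 1"
    then have "snd p \<noteq> 0"
      by auto
    then have "p = x (fst p, Arg (snd p))"
      using * by (simp add: x_def cis_Arg sgn_eq)
    moreover have "(fst p, Arg (snd p)) \<in> U (Arg (snd p) - pi)"
      by (simp add: U_def)
    ultimately show "p \<in> carrier_of cylinder"
      unfolding eq by blast
  qed
  then show ?thesis
    by (simp add: set_eq_iff)
qed

lemma carrier_CP1: "carrier_of CP1 = range (\<lambda>z. proj (1, z)) \<union> range (\<lambda>w. proj (w, 1))"
  by (simp add: carrier_of_def CP1_def)

lemma mem_CP1: "c \<in> CP1 \<longleftrightarrow> c = (UNIV, \<lambda>z. proj (1, z)) \<or> c = (UNIV, \<lambda>w. proj (w, 1))"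
  by (simp add: CP1_def)

lemma cyl_to_C_nonzero: "p \<in> carrier_of cylinder \<Longrightarrow> cyl_to_C p \<noteq> 0"
  by (auto simp: carrier_cylinder cyl_to_C_def)

lemma cyl_to_C_polar:
  assumes "z \<noteq> 0"
  shows "cyl_to_C (ln (cmod z), sgn z) = z"
  using assms by (simp add: cyl_to_C_def sgn_eq)

lemma polar_cyl_to_C:
  assumes "p \<in> carrier_of cylinder"
  shows "(ln (cmod (cyl_to_C p)), sgn (cyl_to_C p)) = p"
  using assms by (auto simp: carrier_cylinder cyl_to_C_def sgn_eq norm_mult)

lemma cyl_to_CP1_image: "cyl_to_CP1 ` carrier_of cylinder = (\<lambda>z. proj (1, z)) ` (- {0})"
proof -
  have "cyl_to_C ` carrier_of cylinder = - {0}"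
  proof (intro equalityI subsetI)
    fix z :: complex assume "z \<in> - {0}"
    then show "z \<in> cyl_to_C ` carrier_of cylinder"
      by (intro image_eqI[where x="(ln (cmod z), sgn z)"])
        (auto simp: cyl_to_C_polar carrier_cylinder norm_sgn)
  qed (use cyl_to_C_nonzero in auto)
  then show ?thesis
    unfolding cyl_to_CP1_def[abs_def] by (metis image_image)
qed

lemma inj_cyl_to_CP1: "inj_on cyl_to_CP1 (carrier_of cylinder)"
  by (intro inj_onI) (metis cyl_to_CP1_def polar_cyl_to_C proj_affine_eq_iff(1))

lemma inv_cyl_to_CP1:
  assumes "z \<noteq> 0"
  shows "inv_into (carrier_of cylinder) cyl_to_CP1 (proj (1, z)) = (ln (cmod z), sgn z)"
  using assms
  by (intro inv_into_f_eq inj_cyl_to_CP1) (auto simp: carrier_cylinder norm_sgn cyl_to_CP1_def cyl_to_C_polar)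

lemma bounded_linear_Complex: "bounded_linear (\<lambda>y :: real \<times> real. Complex (fst y) (snd y))"
  unfolding Complex_eq
  by (intro bounded_linear_add bounded_linear_compose[OF bounded_linear_of_real]
      bounded_linear_compose[OF bounded_linear_mult_right] bounded_linear_fst bounded_linear_snd)

lemma bounded_linear_Re_Im: "bounded_linear (\<lambda>z. (Re z, Im z))"
  by (intro bounded_linear_Pair bounded_linear_Re bounded_linear_Im)

lemma smooth_cyl_to_CP1: "smooth_map_on cylinder CP1 (carrier_of cylinder) cyl_to_CP1"
proof -
  define U where "U a = {(t :: real, \<theta>). a < \<theta> \<and> \<theta> < a + 2 * pi}" for a
  define x where "x = (\<lambda>(t :: real, \<theta>). (t, cis \<theta>))"
  have cyl: "c \<in> cylinder \<longleftrightarrow> (\<exists>a. c = (U a, x))" for c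
    by (auto simp: cylinder_def U_def x_def)
  have U: "open (U a)" for a
    unfolding U_def case_prod_beta by (intro open_Collect_conj open_Collect_less continuous_intros)
  have W: "{y \<in> U a. x y \<in> carrier_of cylinder \<and> cyl_to_CP1 (x y) \<in> range (\<lambda>z. proj (1, z))} = U a"
    "{y \<in> U a. x y \<in> carrier_of cylinder \<and> cyl_to_CP1 (x y) \<in> range (\<lambda>w. proj (w, 1))} = U a" for a
    by (auto simp: x_def carrier_cylinder cyl_to_CP1_def cyl_to_C_eq_exp)
  have eq: "(cyl_to_CP1 \<circ> x) y = proj (1, exp (Complex (fst y) (snd y)))" for y
    by (simp add: x_def cyl_to_CP1_def cyl_to_C_eq_exp case_prod_beta)
  have "smooth_on (U a) (inv_into UNIV (\<lambda>z. proj (1, z)) \<circ> cyl_to_CP1 \<circ> x)" for a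
    by (rule smooth_on_holomorphic[OF bounded_linear_Complex bounded_linear_ident open_UNIV _ U, of exp])
      (auto simp: eq[unfolded o_def] intro: holomorphic_on_exp)
  moreover have "smooth_on (U a) (inv_into UNIV (\<lambda>w. proj (w, 1)) \<circ> cyl_to_CP1 \<circ> x)" for a
    by (rule smooth_on_holomorphic[OF bounded_linear_Complex bounded_linear_ident open_UNIV _ U,
          of "\<lambda>z. 1 / exp z"])
      (auto simp: eq[unfolded o_def] intro!: holomorphic_intros)
  moreover have "cyl_to_CP1 ` carrier_of cylinder \<subseteq> carrier_of CP1"
    by (auto simp: cyl_to_CP1_image carrier_CP1)
  ultimately show ?thesis
    unfolding smooth_map_on_def
    by (auto simp: cyl mem_CP1 Let_def U W)
qed

text \<open>The inverse of a parametrization of the cylinder, read in the coordinate \<open>z\<close>, is the branch \<open>L\<close> of the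
logarithm with imaginary part in the open interval from \<open>a\<close> to \<open>a + 2 \<pi>\<close>: turning the plane by
\<open>- (a + \<pi>)\<close> moves the ray of argument \<open>a\<close> onto the negative real axis, the branch cut
of the principal logarithm.\<close>

lemma log_branch:
  fixes a :: real
  defines "L \<equiv> \<lambda>z. Ln (z * cis (- (a + pi))) + \<i> * of_real (a + pi)"
  defines "W \<equiv> {z. z * cis (- (a + pi)) \<notin> \<real>\<^sub>\<le>\<^sub>0}"
  defines "U \<equiv> {(t :: real, \<theta>). a < \<theta> \<and> \<theta> < a + 2 * pi}" and "x \<equiv> (\<lambda>(t :: real, \<theta>). (t, cis \<theta>))"
  shows "open W" "L holomorphic_on W" "0 \<notin> W"
    and "z \<noteq> 0 \<Longrightarrow> (ln (cmod z), sgn z) \<in> x ` U \<longleftrightarrow> z \<in> W"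
    and "z \<in> W \<Longrightarrow> inv_into U x (ln (cmod z), sgn z) = (Re (L z), Im (L z))"
proof -
  have "closed ((\<lambda>z. z * cis (- (a + pi))) -` \<real>\<^sub>\<le>\<^sub>0)"
    by (intro closed_vimage closed_nonpos_Reals_complex continuous_intros)
  then show "open W"
    unfolding W_def by (simp add: closed_def Compl_eq vimage_def Collect_neg_eq[symmetric])
  show "L holomorphic_on W"
    unfolding L_def W_def by (auto intro!: holomorphic_intros)
  show W0: "0 \<notin> W"
    by (simp add: W_def)
  have inj: "inj_on x U"
  proof (rule inj_onI, clarsimp simp: x_def U_def)
    fix s t :: real assume st: "cis s = cis t" "a < s" "s < a + 2 * pi" "a < t" "t < a + 2 * pi"
    then have "cis (s - t) = 1"
      by (simp add: cis_divide[symmetric])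
    then have "cos (s - t) = 1"
      by (metis cis.sel(1) one_complex.sel(1))
    then obtain n :: int where n: "s - t = of_int n * (2 * pi)"
      by (auto simp: cos_one_2pi_int mult.assoc)
    have "\<bar>s - t\<bar> < 1 * (2 * pi)"
      using st by linarith
    then have "\<bar>real_of_int n\<bar> * (2 * pi) < 1 * (2 * pi)"
      unfolding n by (simp add: abs_mult)
    then have "\<bar>real_of_int n\<bar> < 1"
      by (subst (asm) mult_less_cancel_right_pos) simp_all
    then have "n = 0"
      by linarith
    then show "s = t"
      using n by simp
  qed
  have LW: "(Re (L z), Im (L z)) \<in> U" "x (Re (L z), Im (L z)) = (ln (cmod z), sgn z)" if "z \<in> W" for z
  proof -
    let ?v = "z * cis (- (a + pi))"
    have z: "z \<noteq> 0" and v: "?v \<noteq> 0"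
      using W0 that by auto
    have "Im (Ln ?v) < pi"
      using that v Im_Ln_less_pi[of ?v] unfolding W_def
      by (simp add: complex_nonpos_Reals_iff)
    then show "(Re (L z), Im (L z)) \<in> U"
      using mpi_less_Im_Ln[OF v] by (simp add: L_def U_def)
    have "exp (L z) = z"
      using v unfolding L_def exp_add exp_Ln[OF v] cis_conv_exp[symmetric]
      by (simp add: mult.assoc cis_mult)
    then show "x (Re (L z), Im (L z)) = (ln (cmod z), sgn z)"
      using polar_cyl_to_C[of "x (Re (L z), Im (L z))"]
      by (simp add: x_def carrier_cylinder cyl_to_C_eq_exp)
  qed
  show "inv_into U x (ln (cmod z), sgn z) = (Re (L z), Im (L z))" if "z \<in> W"
    using inv_into_f_eq[OF inj LW[OF that]] .
  assume z: "z \<noteq> 0"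
  show "(ln (cmod z), sgn z) \<in> x ` U \<longleftrightarrow> z \<in> W"
  proof
    assume "(ln (cmod z), sgn z) \<in> x ` U"
    then obtain \<theta> where \<theta>: "sgn z = cis \<theta>" "a < \<theta>" "\<theta> < a + 2 * pi"
      by (auto simp: x_def U_def)
    then have "z = cmod z * cis \<theta>"
      using z by (simp add: sgn_eq field_simps)
    then have "z * cis (- (a + pi)) = cmod z * (cis \<theta> * cis (- (a + pi)))"
      by (metis mult.assoc)
    then have "z * cis (- (a + pi)) = cmod z * cis (\<theta> - (a + pi))"
      by (simp add: cis_mult algebra_simps)
    moreover have "cmod z * cis (\<theta> - (a + pi)) \<notin> \<real>\<^sub>\<le>\<^sub>0"
    proof
      define \<psi> where "\<psi> = \<theta> - (a + pi)"
      assume "cmod z * cis (\<theta> - (a + pi)) \<in> \<real>\<^sub>\<le>\<^sub>0"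
      then have "sin \<psi> = 0" "cos \<psi> \<le> 0"
        using z by (auto simp: complex_nonpos_Reals_iff \<psi>_def mult_le_0_iff)
      moreover have "- pi < \<psi>" "\<psi> < pi"
        using \<theta> by (auto simp: \<psi>_def)
      ultimately show False
        using sin_eq_0_pi[of \<psi>] by auto
    qed
    ultimately show "z \<in> W"
      by (simp add: W_def)
  next
    assume "z \<in> W"
    from LW[OF this] show "(ln (cmod z), sgn z) \<in> x ` U"
      by (metis image_eqI)
  qed
qed

lemma smooth_inv_cyl_to_CP1:
  "smooth_map_on CP1 cylinder (cyl_to_CP1 ` carrier_of cylinder) (inv_into (carrier_of cylinder) cyl_to_CP1)"
proof -
  define f where "f = inv_into (carrier_of cylinder) cyl_to_CP1"
  define V where "V = cyl_to_CP1 ` carrier_of cylinder"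
  define U where "U a = {(t :: real, \<theta>). a < \<theta> \<and> \<theta> < a + 2 * pi}" for a
  define x where "x = (\<lambda>(t :: real, \<theta>). (t, cis \<theta>))"
  have cyl: "c \<in> cylinder \<longleftrightarrow> (\<exists>a. c = (U a, x))" for c
    by (auto simp: cylinder_def U_def x_def)
  define L where "L a z = Ln (z * cis (- (a + pi))) + \<i> * of_real (a + pi)" for a :: real and z
  define W where "W a = {z. z * cis (- (a + pi)) \<notin> \<real>\<^sub>\<le>\<^sub>0}" for a
  have branch: "open (W a)" "L a holomorphic_on W a" "0 \<notin> W a"
    "z \<noteq> 0 \<Longrightarrow> (ln (cmod z), sgn z) \<in> x ` U a \<longleftrightarrow> z \<in> W a"
    "z \<in> W a \<Longrightarrow> inv_into (U a) x (ln (cmod z), sgn z) = (Re (L a z), Im (L a z))" for a z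
    unfolding L_def[abs_def] W_def U_def x_def by (fact log_branch)+
  have V0: "proj (1, z) \<in> V \<longleftrightarrow> z \<noteq> 0" and V1: "proj (z, 1) \<in> V \<longleftrightarrow> z \<noteq> 0" for z
    unfolding V_def cyl_to_CP1_image by auto
  have proj1: "proj (w, 1) = proj (1, 1 / w)" if "w \<noteq> 0" for w
    using that by simp
  have f: "f (proj (1, z)) = (ln (cmod z), sgn z)" if "z \<noteq> 0" for z
    unfolding f_def by (rule inv_cyl_to_CP1[OF that])
  define W' where "W' a = (- {0}) \<inter> (\<lambda>w. 1 / w) -` W a" for a
  have W': "open (W' a)" for a
    unfolding W'_def by (intro continuous_open_preimage branch continuous_intros) auto
  have "proj (1, y) \<in> V \<and> f (proj (1, y)) \<in> x ` U a \<longleftrightarrow> y \<in> W a" for y a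
    using branch(3,4) by (cases "y = 0") (simp_all add: V0 f)
  then have 0: "{y. proj (1, y) \<in> V \<and> f (proj (1, y)) \<in> x ` U a} = W a" for a
    by simp
  have "proj (y, 1) \<in> V \<and> f (proj (y, 1)) \<in> x ` U a \<longleftrightarrow> y \<in> W' a" for y a
    using branch(4)[of "1 / y"] by (cases "y = 0") (simp_all add: V0 V1 f proj1 W'_def)
  then have 1: "{y. proj (y, 1) \<in> V \<and> f (proj (y, 1)) \<in> x ` U a} = W' a" for a
    by simp
  have s0: "smooth_on (W a) (inv_into (U a) x \<circ> f \<circ> (\<lambda>z. proj (1, z)))" for a
  proof (rule smooth_on_holomorphic[OF bounded_linear_ident bounded_linear_Re_Im branch(1,2) branch(1)])
    show "(inv_into (U a) x \<circ> f \<circ> (\<lambda>z. proj (1, z))) z = (Re (L a z), Im (L a z))" if "z \<in> W a" for z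
    proof -
      have "z \<noteq> 0"
        using that branch(3) by metis
      then show ?thesis
        using branch(5)[OF that] by (simp add: f)
    qed
  qed
  have s1: "smooth_on (W' a) (inv_into (U a) x \<circ> f \<circ> (\<lambda>w. proj (w, 1)))" for a
  proof (rule smooth_on_holomorphic[OF bounded_linear_ident bounded_linear_Re_Im W' _ W'])
    have "L a \<circ> (\<lambda>w. 1 / w) holomorphic_on W' a"
      by (rule holomorphic_on_compose_gen[OF _ branch(2)]) (auto simp: W'_def intro!: holomorphic_intros)
    then show "(\<lambda>w. L a (1 / w)) holomorphic_on W' a"
      by (simp add: o_def)
    show "(inv_into (U a) x \<circ> f \<circ> (\<lambda>w. proj (w, 1))) w = (Re (L a (1 / w)), Im (L a (1 / w)))"
      if "w \<in> W' a" for w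
      using that branch(5)[where a=a and z="1 / w"] unfolding W'_def by (simp add: f proj1)
  qed
  have "f ` V \<subseteq> carrier_of cylinder"
    unfolding f_def V_def by (intro image_subsetI inv_into_into)
  then show ?thesis
    unfolding smooth_map_on_def f_def[symmetric] V_def[symmetric]
    by (auto simp: cyl mem_CP1 Let_def 0 1 s0 s1 W' branch(1))
qed

lemma diffeo_cyl_to_CP1: "diffeo_onto_open cylinder CP1 (carrier_of cylinder) cyl_to_CP1"
  unfolding diffeo_onto_open_def
proof (intro conjI smooth_cyl_to_CP1 smooth_inv_cyl_to_CP1 inj_cyl_to_CP1)
  have U: "open {(t :: real, \<theta>). a < \<theta> \<and> \<theta> < a + 2 * pi}" for a :: real
    unfolding case_prod_beta by (intro open_Collect_conj open_Collect_less continuous_intros)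
  then have charts: "open U" if "(U, x) \<in> cylinder" for U x
    using that by (auto simp: cylinder_def)
  have "{y \<in> U. x y \<in> carrier_of cylinder} = U" if "(U, x) \<in> cylinder" for U x
    using that by (auto simp: carrier_of_def)
  then show "openin (manifold_topology cylinder) (carrier_of cylinder)"
    using charts by (subst openin_manifold_topology[OF charts]) auto
  have "{z. proj (1, z) \<in> (\<lambda>z. proj (1, z)) ` (- {0})} = - {0}"
    "{w. proj (w, 1) \<in> (\<lambda>z. proj (1, z)) ` (- {0})} = - {0}"
    by auto
  then show "openin (manifold_topology CP1) (cyl_to_CP1 ` carrier_of cylinder)"
    by (subst openin_manifold_topology) (auto simp: CP1_def carrier_CP1[unfolded CP1_def] cyl_to_CP1_image)
qed

section \<open>Lengths of curves to the poles\<close>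

text \<open>The derivative \<open>D\<close> may be unbounded near the finitely many exceptional points, hence the fundamental theorem
is used for the gauge integral. If the integral of \<open>\<bar>D\<bar>\<close> is finite, then both integrals of
\<open>D\<close> agree.\<close>

lemma variation_le_nn_integral:
  fixes \<phi> D :: "real \<Rightarrow> real"
  assumes "a \<le> b" "finite S" "continuous_on {a..b} \<phi>" and D: "D \<in> borel_measurable borel"
    and der: "\<And>x. x \<in> {a..b} - S \<Longrightarrow> (\<phi> has_real_derivative D x) (at x)"
  shows "ennreal \<bar>\<phi> b - \<phi> a\<bar> \<le> (\<integral>\<^sup>+ x \<in> {a..b}. ennreal \<bar>D x\<bar> \<partial>lborel)"
proof (cases "(\<integral>\<^sup>+ x \<in> {a..b}. ennreal \<bar>D x\<bar> \<partial>lborel) = \<infinity>")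
  case False
  define f where "f x = indicator {a..b} x *\<^sub>R D x" for x
  have eq: "(\<integral>\<^sup>+ x. ennreal (norm (f x)) \<partial>lborel) = (\<integral>\<^sup>+ x \<in> {a..b}. ennreal \<bar>D x\<bar> \<partial>lborel)"
    by (rule nn_integral_cong) (simp add: f_def indicator_def)
  have "f \<in> borel_measurable lborel"
    unfolding f_def using D by measurable
  then have f: "integrable lborel f"
    using False eq by (intro integrableI_bounded) (auto simp: top.not_eq_extremum)
  have "(D has_integral (\<phi> b - \<phi> a)) {a..b}"
    using assms(1-3) der
    by (intro fundamental_theorem_of_calculus_strong[of S])
      (auto simp: has_real_derivative_iff_has_vector_derivative)
  then have "(f has_integral (\<phi> b - \<phi> a)) UNIV"
    unfolding has_integral_restrict_UNIV[of "{a..b}" D, symmetric] f_def[abs_def] indicator_scaleR_eq_if .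
  then have "integral\<^sup>L lborel f = \<phi> b - \<phi> a"
    using has_integral_integral_lborel[OF f] has_integral_unique by blast
  then show ?thesis
    using integral_norm_bound_ennreal[OF f] eq by simp
qed simp

text \<open>The height function of the round sphere. It serves to find the first time at which a curve leaves a
compact part of the cylinder: it is defined at the poles, and is \<open>tanh t\<close> on the cylinder.
The value does not depend on the chosen vector of the line.\<close>

definition height :: "(complex \<times> complex) set \<Rightarrow> real" where
  "height q = (let (z0, z1) = SOME v. v \<noteq> 0 \<and> v \<in> q
     in ((cmod z1)\<^sup>2 - (cmod z0)\<^sup>2) / ((cmod z0)\<^sup>2 + (cmod z1)\<^sup>2))"

lemma height_proj:
  assumes "(z0, z1) \<noteq> 0"
  shows "height (proj (z0, z1)) = ((cmod z1)\<^sup>2 - (cmod z0)\<^sup>2) / ((cmod z0)\<^sup>2 + (cmod z1)\<^sup>2)"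
proof -
  define v where "v = (SOME v. v \<noteq> 0 \<and> v \<in> proj (z0, z1))"
  have "(z0, z1) \<in> proj (z0, z1)"
    unfolding proj_def by (auto intro: exI[of _ 1])
  then have "\<exists>v. v \<noteq> 0 \<and> v \<in> proj (z0, z1)"
    using assms by blast
  then have v: "v \<noteq> 0 \<and> v \<in> proj (z0, z1)"
    unfolding v_def by (rule someI_ex)
  then obtain c where c: "v = (c * z0, c * z1)"
    unfolding proj_def by auto
  then have c0: "c \<noteq> 0"
    using v by (auto simp: zero_prod_def)
  have "(cmod (c * z1))\<^sup>2 - (cmod (c * z0))\<^sup>2 = (cmod c)\<^sup>2 * ((cmod z1)\<^sup>2 - (cmod z0)\<^sup>2)"
    "(cmod (c * z0))\<^sup>2 + (cmod (c * z1))\<^sup>2 = (cmod c)\<^sup>2 * ((cmod z0)\<^sup>2 + (cmod z1)\<^sup>2)"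
    by (simp_all add: norm_mult power_mult_distrib algebra_simps)
  then show ?thesis
    using c0 unfolding height_def v_def[symmetric] c by simp
qed

lemma height_charts:
  "height (proj (1, z)) = ((cmod z)\<^sup>2 - 1) / (1 + (cmod z)\<^sup>2)"
  "height (proj (w, 1)) = (1 - (cmod w)\<^sup>2) / ((cmod w)\<^sup>2 + 1)"
  by (simp_all add: height_proj zero_prod_def)

lemma height_tanh:
  assumes "z \<noteq> 0"
  shows "height (proj (1, z)) = tanh (ln (cmod z))"
  using assms by (simp add: height_charts tanh_ln_real add.commute)

lemma CP1_cases:
  assumes "q \<in> carrier_of CP1"
  obtains z where "z \<noteq> 0" "q = proj (1, z)" | "q = proj (1, 0)" | "q = proj (0, 1)"
proof -
  consider z where "q = proj (1, z)" | w where "q = proj (w, 1)"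
    using assms unfolding carrier_CP1 by blast
  then show thesis
  proof cases
    case (1 z)
    then show ?thesis
      using that(1,2) by (cases "z = 0") auto
  next
    case (2 w)
    then have "w \<noteq> 0 \<Longrightarrow> q = proj (1, 1 / w)"
      by simp
    then show ?thesis
      using that(1)[of "1 / w"] that(3) 2 by (cases "w = 0") auto
  qed
qed

lemma piecewise_C1_curveD:
  assumes "piecewise_C1_curve M \<gamma>" "t \<in> {0..1}" "(U, x) \<in> M" "\<gamma> t \<in> x ` U"
  obtains e where "e > 0" "\<gamma> ` ({0..1} \<inter> {t - e..t + e}) \<subseteq> x ` U"
    "(inv_into U x \<circ> \<gamma>) piecewise_C1_differentiable_on ({0..1} \<inter> {t - e..t + e})"
proof -
  have "\<forall>c \<in> M. case c of (U, x) \<Rightarrow> \<gamma> t \<in> x ` U \<longrightarrow>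
        (\<exists>e>0. \<gamma> ` ({0..1} \<inter> {t - e..t + e}) \<subseteq> x ` U \<and>
               (inv_into U x \<circ> \<gamma>) piecewise_C1_differentiable_on ({0..1} \<inter> {t - e..t + e}))"
    using assms(1,2) unfolding piecewise_C1_curve_def by blast
  from bspec[OF this assms(3)] show thesis
    using assms(4) that by auto
qed

lemma height_continuous:
  assumes \<gamma>: "piecewise_C1_curve CP1 \<gamma>"
  shows "continuous_on {0..1} (height \<circ> \<gamma>)"
  unfolding continuous_on_eq_continuous_within
proof
  fix t :: real assume t: "t \<in> {0..1}"
  have chart: "continuous (at t within {0..1}) (height \<circ> \<gamma>)"
    if c: "(UNIV, x) \<in> CP1" and q: "\<gamma> t \<in> range x" and inj: "inj x"
      and hx: "continuous_on UNIV (height \<circ> x)" for x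
  proof -
    obtain e where e: "e > 0" "\<gamma> ` ({0..1} \<inter> {t - e..t + e}) \<subseteq> range x"
      "(inv x \<circ> \<gamma>) piecewise_C1_differentiable_on ({0..1} \<inter> {t - e..t + e})"
      using piecewise_C1_curveD[OF \<gamma> t c q] .
    have "continuous_on ({0..1} \<inter> {t - e..t + e}) ((height \<circ> x) \<circ> (inv x \<circ> \<gamma>))"
      using e(3) hx unfolding piecewise_C1_differentiable_on_def
      by (intro continuous_on_compose continuous_on_subset[OF hx]) auto
    moreover have "((height \<circ> x) \<circ> (inv x \<circ> \<gamma>)) s = (height \<circ> \<gamma>) s" if "s \<in> {0..1} \<inter> {t - e..t + e}" for s
    proof -
      have "\<gamma> s \<in> range x"
        using e(2) that by blast
      then show ?thesis
        by (simp add: f_inv_into_f)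
    qed
    ultimately have "continuous_on ({0..1} \<inter> {t - e..t + e}) (height \<circ> \<gamma>)"
      by (rule continuous_on_eq)
    then have "continuous (at t within {0..1} \<inter> {t - e..t + e}) (height \<circ> \<gamma>)"
      unfolding continuous_on_eq_continuous_within using t e(1) by auto
    moreover have "at t within {0..1} \<inter> {t - e..t + e} = at t within {0..1}"
      using e(1) by (intro at_within_nhd[of _ "{t - e<..<t + e}"]) auto
    ultimately show ?thesis
      by simp
  qed
  have "\<gamma> t \<in> carrier_of CP1"
    using \<gamma> t by (auto simp: piecewise_C1_curve_def)
  moreover have pos: "1 + r\<^sup>2 \<noteq> 0" "r\<^sup>2 + 1 \<noteq> 0" for r :: real
    using zero_le_power2[of r] by linarith+
  have "continuous_on UNIV (height \<circ> (\<lambda>z. proj (1, z)))"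
    "continuous_on UNIV (height \<circ> (\<lambda>w. proj (w, 1)))"
    unfolding o_def height_charts using pos by (auto intro!: continuous_intros)
  note chart[OF _ _ _ this(1)] chart[OF _ _ _ this(2)]
  ultimately show "continuous (at t within {0..1}) (height \<circ> \<gamma>)"
    unfolding carrier_CP1 by (auto simp: mem_CP1 inj_def)
qed

lemma param_at_CP1:
  "param_at CP1 (proj (1, z)) = (UNIV, \<lambda>z. proj (1, z)) \<or>
   z \<noteq> 0 \<and> param_at CP1 (proj (1, z)) = (UNIV, \<lambda>w. proj (w, 1))"
proof -
  have "param_at CP1 (proj (1, z)) \<in> CP1 \<and>
      proj (1, z) \<in> snd (param_at CP1 (proj (1, z))) ` fst (param_at CP1 (proj (1, z)))"
    unfolding param_at_def
    by (rule someI_ex, rule exI[of _ "(UNIV, \<lambda>z. proj (1, z))"]) (simp add: mem_CP1)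
  then show ?thesis
    by (auto simp: mem_CP1)
qed

text \<open>The pullback determines the metric in the chart that \<^const>\<open>param_at\<close> chooses at the point, which is
the same choice that enters the speed of a curve. Both affine coordinates are \<open>exp (\<plusminus> (t + \<i> \<theta>))\<close>, so
in either of them the metric is \<open>\<rho>\<close> times the squared modulus of the logarithmic derivative
of the coordinate.\<close>

lemma conformal_tensor:
  assumes g: "\<And>U x y v w. (U, x) \<in> cylinder \<Longrightarrow> y \<in> U \<Longrightarrow>
      pullback CP1 cyl_to_CP1 g (U, x) y v w = cyl_tensor \<rho> (U, x) y v w"
    and z: "z \<noteq> 0"
  defines "c \<equiv> param_at CP1 (proj (1, z))"
  shows "c = (UNIV, \<lambda>z. proj (1, z)) \<Longrightarrow> g c z v v = \<rho> (ln (cmod z)) * (cmod (v / z))\<^sup>2"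
    and "c = (UNIV, \<lambda>w. proj (w, 1)) \<Longrightarrow> g c (1 / z) v v = \<rho> (ln (cmod z)) * (cmod (v * z))\<^sup>2"
proof -
  define a where "a = Arg z - pi"
  define U where "U = {(t :: real, \<theta>). a < \<theta> \<and> \<theta> < a + 2 * pi}"
  define x where "x = (\<lambda>(t :: real, \<theta>). (t, cis \<theta>))"
  define y where "y = (ln (cmod z), Arg z)"
  have U: "(U, x) \<in> cylinder"
    unfolding cylinder_def U_def x_def by blast
  have y: "y \<in> U"
    by (simp add: U_def y_def a_def)
  have expC: "cyl_to_CP1 (x y) = proj (1, exp (Complex (fst y) (snd y)))" for y
    by (simp add: x_def cyl_to_CP1_def cyl_to_C_eq_exp case_prod_beta)
  have zy: "exp (Complex (fst y) (snd y)) = z"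
    using z by (simp add: y_def exp_eq_polar rcis_cmod_Arg[unfolded rcis_def])
  have q: "cyl_to_CP1 (x y) = proj (1, z)"
    by (simp add: expC zy)
  note Cder = bounded_linear_imp_has_derivative[OF bounded_linear_Complex, of "at y"]
  have der0: "((\<lambda>y. exp (Complex (fst y) (snd y))) has_derivative (\<lambda>v. z * Complex (fst v) (snd v))) (at y)"
    using has_derivative_compose[OF Cder DERIV_exp[unfolded has_field_derivative_def]] by (simp add: zy mult.commute)
  have key: "pullback CP1 cyl_to_CP1 g (U, x) y v w =
      g c (f y) (D v) (D w)"
    if "c = (UNIV, p)" "\<And>y. inv p (proj (1, exp (Complex (fst y) (snd y)))) = f y" "(f has_derivative D) (at y)"
    for p f D v w
  proof -
    have "inv p \<circ> cyl_to_CP1 \<circ> x = f"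
      using that(2) by (simp add: fun_eq_iff expC)
    then show ?thesis
      unfolding pullback_def using that(1) frechet_derivative_at[OF that(3)]
      by (simp add: q c_def[symmetric] Let_def that(2)[of y, unfolded zy])
  qed
  have sq: "(cmod u)\<^sup>2 = (Re u, Im u) \<bullet> (Re u, Im u)" for u
    unfolding cmod_power2 by (simp add: power2_eq_square)
  show "g c z v v = \<rho> (ln (cmod z)) * (cmod (v / z))\<^sup>2" if c: "c = (UNIV, \<lambda>z. proj (1, z))"
  proof -
    define r where "r = (Re (v / z), Im (v / z))"
    have "z * Complex (fst r) (snd r) = v"
      using z by (simp add: r_def)
    then have "g c z v v = pullback CP1 cyl_to_CP1 g (U, x) y r r"
      using key[OF c inv_chart_0 der0] by (simp add: zy)
    then show ?thesis
      by (simp only: g[OF U y] cyl_tensor_def sq r_def[symmetric]) (simp add: y_def)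
  qed
  show "g c (1 / z) v v = \<rho> (ln (cmod z)) * (cmod (v * z))\<^sup>2" if c: "c = (UNIV, \<lambda>w. proj (w, 1))"
  proof -
    define a where "a = - v * z"
    define r where "r = (Re a, Im a)"
    have der1: "((\<lambda>y. 1 / exp (Complex (fst y) (snd y))) has_derivative
        (\<lambda>v. - (Complex (fst v) (snd v) / z))) (at y)"
      using z by (auto intro!: derivative_eq_intros der0 simp: zy field_simps)
    have "Complex (fst r) (snd r) = a"
      by (simp add: r_def)
    then have "- (Complex (fst r) (snd r) / z) = v"
      using z by (simp add: a_def)
    then have "g c (1 / z) v v = pullback CP1 cyl_to_CP1 g (U, x) y r r"
      using key[OF c inv_chart_1[OF exp_not_eq_zero] der1] by (simp add: zy)
    moreover have "(cmod (v * z))\<^sup>2 = (cmod a)\<^sup>2"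
      by (simp add: a_def norm_mult)
    ultimately show ?thesis
      by (simp only: g[OF U y] cyl_tensor_def sq r_def[symmetric]) (simp add: y_def)
  qed
qed

lemma speed_conformal:
  assumes g: "\<And>U x y v w. (U, x) \<in> cylinder \<Longrightarrow> y \<in> U \<Longrightarrow>
      pullback CP1 cyl_to_CP1 g (U, x) y v w = cyl_tensor \<rho> (U, x) y v w"
    and \<gamma>: "\<forall>\<^sub>F s in nhds t. \<gamma> s = proj (1, \<zeta> s)" and nz: "\<zeta> t \<noteq> 0"
    and \<zeta>: "(\<zeta> has_vector_derivative v) (at t)"
  shows "speed CP1 g \<gamma> t = sqrt (\<rho> (ln (cmod (\<zeta> t))) * (cmod (v / \<zeta> t))\<^sup>2)"
proof -
  have \<gamma>t: "\<gamma> t = proj (1, \<zeta> t)"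
    using \<gamma> by (rule eventually_nhds_x_imp_x)
  define c where "c = param_at CP1 (proj (1, \<zeta> t))"
  have vd: "vector_derivative f (at t) = w"
    if "\<forall>\<^sub>F s in nhds t. f s = f' s" "(f' has_vector_derivative w) (at t)" for f f' :: "real \<Rightarrow> complex" and w
  proof -
    have "\<forall>\<^sub>F s in at t. f' s = f s" "f' t = f t"
      using that(1) unfolding eventually_nhds_conv_at by (auto elim: eventually_mono)
    then have "(f has_vector_derivative w) (at t)"
      using that(2) unfolding has_vector_derivative_def
      by (intro has_derivative_transform_eventually[of f' _ t UNIV f]) auto
    then show ?thesis
      by (rule vector_derivative_at)
  qed
  have tensor: "c = (UNIV, \<lambda>z. proj (1, z)) \<Longrightarrow> g c (\<zeta> t) a a = \<rho> (ln (cmod (\<zeta> t))) * (cmod (a / \<zeta> t))\<^sup>2"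
    "c = (UNIV, \<lambda>w. proj (w, 1)) \<Longrightarrow> g c (1 / \<zeta> t) a a = \<rho> (ln (cmod (\<zeta> t))) * (cmod (a * \<zeta> t))\<^sup>2" for a
    unfolding c_def using conformal_tensor[where \<rho>=\<rho>, OF _ nz] g by blast+
  consider "c = (UNIV, \<lambda>z. proj (1, z))" | "c = (UNIV, \<lambda>w. proj (w, 1))"
    using param_at_CP1[of "\<zeta> t"] unfolding c_def by blast
  then show ?thesis
  proof cases
    case 1
    have "vector_derivative (inv (\<lambda>z. proj (1, z)) \<circ> \<gamma>) (at t) = v"
      using \<gamma> by (intro vd[OF _ \<zeta>]) (auto elim!: eventually_mono)
    then show ?thesis
      using tensor(1)[OF 1]
      by (simp add: speed_def \<gamma>t c_def[symmetric] 1)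
  next
    case 2
    have "((\<lambda>s. 1 / \<zeta> s) has_vector_derivative - (v / (\<zeta> t)\<^sup>2)) (at t)"
      using \<zeta> nz unfolding has_vector_derivative_def
      by (auto intro!: derivative_eq_intros simp: power2_eq_square field_simps scaleR_conv_of_real)
    moreover have "\<forall>\<^sub>F s in nhds t. \<zeta> s \<noteq> 0"
    proof -
      have "(\<zeta> \<longlongrightarrow> \<zeta> t) (nhds t)"
        using has_vector_derivative_continuous[OF \<zeta>] by (simp add: isCont_def tendsto_at_iff_tendsto_nhds)
      then show ?thesis
        using nz by (rule tendsto_imp_eventually_ne)
    qed
    then have "\<forall>\<^sub>F s in nhds t. (inv (\<lambda>w. proj (w, 1)) \<circ> \<gamma>) s = 1 / \<zeta> s"
      using \<gamma> by eventually_elim simp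
    ultimately have "vector_derivative (inv (\<lambda>w. proj (w, 1)) \<circ> \<gamma>) (at t) = - (v / (\<zeta> t)\<^sup>2)"
      by (intro vd)
    then show ?thesis
      using tensor(2)[OF 2, of "- (v / (\<zeta> t)\<^sup>2)"] nz
      by (simp add: speed_def \<gamma>t c_def[symmetric] 2 power2_eq_square)
  qed
qed

text \<open>Up to the first time \<open>T\<close> at which the height has modulus \<open>tanh R\<close>, the curve stays in
the region \<open>\<bar>t\<bar> \<le> R\<close>. There its speed is at least the absolute value of the derivative of its
coordinate \<open>t\<close>, which changes from \<open>0\<close> to \<open>\<plusminus> R\<close>. The definition of a piecewise C1
curve is local; Bolzano's bisection principle assembles the local data into one finite exceptional set and
one measurable derivative on \<open>{0..T}\<close>.\<close>

lemma curve_length_to_pole: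
  assumes g: "\<And>U x y v w. (U, x) \<in> cylinder \<Longrightarrow> y \<in> U \<Longrightarrow>
      pullback CP1 cyl_to_CP1 g (U, x) y v w = cyl_tensor \<rho> (U, x) y v w"
    and \<rho>: "\<And>t. \<bar>t\<bar> \<le> R \<Longrightarrow> \<rho> t \<ge> 1" and R: "R > 0"
    and \<gamma>: "piecewise_C1_curve CP1 \<gamma>"
    and start: "p \<in> carrier_of cylinder" "fst p = 0" "\<gamma> 0 = cyl_to_CP1 p"
    and pole: "\<gamma> 1 \<notin> cyl_to_CP1 ` carrier_of cylinder"
  shows "curve_length CP1 g \<gamma> \<ge> ennreal R"
proof -
  define \<beta> where "\<beta> t = \<bar>height (\<gamma> t)\<bar>" for t
  define \<zeta> where "\<zeta> = inv (\<lambda>z. proj (1, z)) \<circ> \<gamma>"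
  \<comment> \<open>The coordinate \<open>z\<close> along the curve; at the pole \<open>proj (0, 1)\<close> it has an arbitrary value.\<close>
  have carrier: "\<gamma> t \<in> carrier_of CP1" if "t \<in> {0..1}" for t
    using \<gamma> that by (auto simp: piecewise_C1_curve_def)
  have cont: "continuous_on {0..1} \<beta>"
    unfolding \<beta>_def using height_continuous[OF \<gamma>] by (simp add: o_def continuous_on_rabs)
  have \<gamma>0: "\<gamma> 0 = proj (1, cyl_to_C p)" "cmod (cyl_to_C p) = 1"
    using start by (auto simp: cyl_to_CP1_def cyl_to_C_def carrier_cylinder)
  have "\<beta> 0 = 0"
    unfolding \<beta>_def \<gamma>0 by (simp add: height_charts \<gamma>0)
  moreover have "\<beta> 1 = 1"
    using carrier[of 1] pole unfolding \<beta>_def cyl_to_CP1_image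
    by (auto elim!: CP1_cases simp: height_charts)
  ultimately have bound: "\<beta> 0 < tanh R" "tanh R < \<beta> 1"
    using R tanh_real_lt_1 by auto
  define A where "A = {t \<in> {0..1}. \<beta> t = tanh R}"
  have "compact A"
  proof -
    have "closed A"
      unfolding A_def using cont by (intro continuous_closed_preimage_constant) auto
    moreover have "bounded A"
      by (rule bounded_subset[of "{0..1}"]) (auto simp: A_def)
    ultimately show ?thesis
      by (simp add: compact_eq_bounded_closed)
  qed
  moreover have "A \<noteq> {}"
    using IVT'[OF less_imp_le[OF bound(1)] less_imp_le[OF bound(2)] _ cont] by (auto simp: A_def)
  ultimately obtain T where T: "T \<in> A" "\<And>t. t \<in> A \<Longrightarrow> T \<le> t"
    using compact_attains_inf[of A] by metis
  then have \<beta>T: "\<beta> T = tanh R" and "0 \<le> T" "T \<le> 1"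
    by (auto simp: A_def)
  moreover have "T \<noteq> 0" "T \<noteq> 1"
    using bound \<beta>T by auto
  ultimately have T01: "0 < T" "T < 1"
    by simp_all
  have below: "\<beta> t \<le> tanh R" if "t \<in> {0..T}" for t
  proof (rule ccontr)
    assume "\<not> \<beta> t \<le> tanh R"
    then have "\<exists>s. 0 \<le> s \<and> s \<le> t \<and> \<beta> s = tanh R"
      using that T01 bound by (intro IVT' continuous_on_subset[OF cont]) auto
    then obtain s where s: "0 \<le> s" "s \<le> t" "\<beta> s = tanh R"
      by blast
    then have "T \<le> s"
      using that T01 by (intro T(2)) (auto simp: A_def)
    then have "t = s"
      using s that by simp
    then show False
      using \<open>\<not> \<beta> t \<le> tanh R\<close> s by simp
  qed
  have nz: "\<zeta> t \<noteq> 0" and \<gamma>\<zeta>: "\<gamma> t = proj (1, \<zeta> t)" and range: "\<bar>ln (cmod (\<zeta> t))\<bar> \<le> R"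
    and \<beta>\<zeta>: "\<beta> t = tanh \<bar>ln (cmod (\<zeta> t))\<bar>"
    if t: "t \<in> {0..T}" for t
  proof -
    have "t \<in> {0..1}"
      using t T01 by auto
    from carrier[OF this] obtain z where z: "z \<noteq> 0" "\<gamma> t = proj (1, z)"
    proof (cases rule: CP1_cases)
      case 2
      then have "\<beta> t = 1"
        by (simp add: \<beta>_def height_charts)
      then show ?thesis
        using below[OF t] tanh_real_lt_1[of R] by simp
    next
      case 3
      then have "\<beta> t = 1"
        by (simp add: \<beta>_def height_charts)
      then show ?thesis
        using below[OF t] tanh_real_lt_1[of R] by simp
    qed
    then have \<zeta>z: "\<zeta> t = z"
      by (simp add: \<zeta>_def)
    show "\<zeta> t \<noteq> 0" "\<gamma> t = proj (1, \<zeta> t)"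
      using z \<zeta>z by auto
    show "\<beta> t = tanh \<bar>ln (cmod (\<zeta> t))\<bar>"
      using z \<zeta>z by (simp add: \<beta>_def height_tanh)
    then show "\<bar>ln (cmod (\<zeta> t))\<bar> \<le> R"
      using below[OF t] by (simp del: tanh_real_abs)
  qed
  define \<phi> where "\<phi> t = ln (cmod (\<zeta> t))" for t
  have local: "\<exists>e>0. continuous_on ({0..T} \<inter> {t - e..t + e}) \<zeta> \<and>
      (\<exists>S. finite S \<and> \<zeta> C1_differentiable_on ({0..1} \<inter> {t - e..t + e} - S))" if t: "t \<in> {0..T}" for t
  proof -
    have "(UNIV, \<lambda>z. proj (1, z)) \<in> CP1" "\<gamma> t \<in> range (\<lambda>z. proj (1, z))" "t \<in> {0..1}"
      using \<gamma>\<zeta>[OF t] t T01 by (auto simp: mem_CP1)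
    then obtain e where "e > 0" "\<zeta> piecewise_C1_differentiable_on ({0..1} \<inter> {t - e..t + e})"
      unfolding \<zeta>_def using piecewise_C1_curveD[OF \<gamma>] by metis
    moreover have "{0..T} \<inter> {t - e..t + e} \<subseteq> {0..1} \<inter> {t - e..t + e}"
      using T01 by auto
    ultimately show ?thesis
      unfolding piecewise_C1_differentiable_on_def by (meson continuous_on_subset)
  qed
  have cont\<zeta>: "continuous_on {0..T} \<zeta>"
    unfolding continuous_on_eq_continuous_within
  proof
    fix t assume t: "t \<in> {0..T}"
    then obtain e where e: "e > 0" "continuous_on ({0..T} \<inter> {t - e..t + e}) \<zeta>"
      using local by blast
    have "at t within {0..T} \<inter> {t - e..t + e} = at t within {0..T}"
      using e(1) by (intro at_within_nhd[of _ "{t - e<..<t + e}"]) auto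
    then show "continuous (at t within {0..T}) \<zeta>"
      using e t by (metis IntI atLeastAtMost_iff continuous_on_eq_continuous_within diff_le_eq le_add_same_cancel1 less_imp_le)
  qed
  then have cont\<phi>: "continuous_on {0..T} \<phi>"
    unfolding \<phi>_def using nz by (intro continuous_intros) auto
  have event: "\<forall>\<^sub>F s in nhds t. \<gamma> s = proj (1, \<zeta> s)" if "t \<in> {0<..<T}" for t
    using \<gamma>\<zeta> eventually_nhds_in_open[OF open_greaterThanLessThan that] by (auto elim!: eventually_mono)
  \<comment> \<open>Outside the interval from \<open>0\<close> to \<open>T\<close> the predicate holds vacuously, since the local condition for bisection also ranges over such intervals.\<close>
  define P where "P a b \<longleftrightarrow> (0 \<le> a \<and> b \<le> T \<longrightarrow> (\<exists>D S. D \<in> borel_measurable borel \<and> finite S \<and>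
      (\<forall>t \<in> {a..b} - S. (\<phi> has_real_derivative D t) (at t) \<and> \<bar>D t\<bar> \<le> speed CP1 g \<gamma> t)))" for a b
  have "P 0 T"
  proof (rule Bolzano[of 0 T P])
    show "P a c" if "P a b" "P b c" "a \<le> b" "b \<le> c" for a b c
      unfolding P_def
    proof
      assume "0 \<le> a \<and> c \<le> T"
      then have "0 \<le> a \<and> b \<le> T" "0 \<le> b \<and> c \<le> T"
        using that(3,4) by linarith+
      with that(1,2) obtain D S D' S' where D: "D \<in> borel_measurable borel" "D' \<in> borel_measurable borel"
        and S: "finite S" "finite S'"
        and *: "\<forall>t \<in> {a..b} - S. (\<phi> has_real_derivative D t) (at t) \<and> \<bar>D t\<bar> \<le> speed CP1 g \<gamma> t"
          "\<forall>t \<in> {b..c} - S'. (\<phi> has_real_derivative D' t) (at t) \<and> \<bar>D' t\<bar> \<le> speed CP1 g \<gamma> t"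
        unfolding P_def by blast
      have "(\<lambda>t. if t \<le> b then D t else D' t) \<in> borel_measurable borel"
        using D by measurable
      moreover have "(\<phi> has_real_derivative (if t \<le> b then D t else D' t)) (at t) \<and>
          \<bar>if t \<le> b then D t else D' t\<bar> \<le> speed CP1 g \<gamma> t" if "t \<in> {a..c} - (S \<union> S')" for t
        using * that by (cases "t \<le> b") auto
      ultimately show "\<exists>D S. D \<in> borel_measurable borel \<and> finite S \<and>
          (\<forall>t \<in> {a..c} - S. (\<phi> has_real_derivative D t) (at t) \<and> \<bar>D t\<bar> \<le> speed CP1 g \<gamma> t)"
        using S by (intro exI[of _ "\<lambda>t. if t \<le> b then D t else D' t"] exI[of _ "S \<union> S'"]) blast
    qed
    fix t assume "0 \<le> t" "t \<le> T"
    then obtain e S where e: "e > 0" and S: "finite S"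
      and C1: "\<zeta> C1_differentiable_on ({0..1} \<inter> {t - e..t + e} - S)"
      using local[of t] by auto
    have "P a b" if ab: "a \<le> t" "t \<le> b" "b - a < e" for a b
      unfolding P_def
    proof
      assume "0 \<le> a \<and> b \<le> T"
      then have sub: "{a..b} \<subseteq> {0..T}" "{a..b} - (S \<union> {0, T}) \<subseteq> {0..1} \<inter> {t - e..t + e} - S"
        using ab T01 by auto
      \<comment> \<open>The endpoints are removed since the speed is defined by a two-sided derivative of the curve.\<close>
      define B where "B = {a..b} - (S \<union> {0, T})"
      obtain V where V: "\<And>s. s \<in> B \<Longrightarrow> (\<zeta> has_vector_derivative V s) (at s)" and contV: "continuous_on B V"
        using C1 sub(2) unfolding C1_differentiable_on_def B_def by (meson continuous_on_subset subsetD)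
      define D where "D = (\<lambda>s. indicator B s *\<^sub>R Re (V s / \<zeta> s))"
      have B: "B \<subseteq> {0<..<T}"
        using sub unfolding B_def by force
      have "continuous_on B (\<lambda>s. Re (V s / \<zeta> s))"
        using contV B nz by (intro continuous_intros continuous_on_subset[OF cont\<zeta>]) fastforce+
      moreover have "B \<in> sets borel"
        unfolding B_def using S
        by (intro sets.Diff) (auto intro!: borel_closed[OF finite_imp_closed])
      ultimately have D: "D \<in> borel_measurable borel"
        unfolding D_def by (intro borel_measurable_continuous_on_indicator)
      have "(\<phi> has_real_derivative D s) (at s) \<and> \<bar>D s\<bar> \<le> speed CP1 g \<gamma> s" if s: "s \<in> B" for s
      proof
        have s0: "s \<in> {0..T}" "s \<in> {0<..<T}"
          using s B by auto
        have Ds: "D s = Re (V s / \<zeta> s)"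
          using s by (simp add: D_def)
        have "((\<lambda>s. ln (cmod (\<zeta> s))) has_derivative (\<lambda>h. Re ((h *\<^sub>R V s) / \<zeta> s))) (at s)"
          using has_derivative_compose[OF V[OF s, unfolded has_vector_derivative_def]
              has_derivative_ln_cmod[OF nz[OF s0(1)]]] .
        moreover have "Re ((h *\<^sub>R V s) / \<zeta> s) = Re (V s / \<zeta> s) * h" for h
        proof -
          have "(h *\<^sub>R V s) / \<zeta> s = h *\<^sub>R (V s / \<zeta> s)"
            by (simp add: scaleR_conv_of_real)
          then show ?thesis
            by (simp add: mult.commute)
        qed
        ultimately show "(\<phi> has_real_derivative D s) (at s)"
          unfolding \<phi>_def has_field_derivative_def Ds by simp
        have "\<bar>D s\<bar> \<le> cmod (V s / \<zeta> s)"
          unfolding Ds by (rule abs_Re_le_cmod)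
        also have "\<dots> = sqrt ((cmod (V s / \<zeta> s))\<^sup>2)"
          by simp
        also have "\<dots> \<le> sqrt (\<rho> (ln (cmod (\<zeta> s))) * (cmod (V s / \<zeta> s))\<^sup>2)"
          using mult_right_mono[OF \<rho>[OF range[OF s0(1)]], of "(cmod (V s / \<zeta> s))\<^sup>2"]
          by (intro real_sqrt_le_mono) simp
        also have "\<dots> = speed CP1 g \<gamma> s"
          by (rule speed_conformal[OF g event[OF s0(2)] nz[OF s0(1)] V[OF s], symmetric])
        finally show "\<bar>D s\<bar> \<le> speed CP1 g \<gamma> s" .
      qed
      then show "\<exists>D S. D \<in> borel_measurable borel \<and> finite S \<and>
          (\<forall>t \<in> {a..b} - S. (\<phi> has_real_derivative D t) (at t) \<and> \<bar>D t\<bar> \<le> speed CP1 g \<gamma> t)"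
        using D S unfolding B_def by (intro exI[of _ D] exI[of _ "S \<union> {0, T}"]) blast
    qed
    then show "\<exists>d>0. \<forall>a b. a \<le> t \<and> t \<le> b \<and> b - a < d \<longrightarrow> P a b"
      using e by blast
  qed (use T01 in simp)
  then obtain D S where D: "D \<in> borel_measurable borel" and S: "finite S"
    and DS: "\<And>t. t \<in> {0..T} - S \<Longrightarrow> (\<phi> has_real_derivative D t) (at t) \<and> \<bar>D t\<bar> \<le> speed CP1 g \<gamma> t"
    unfolding P_def by auto
  have "\<phi> 0 = 0"
    unfolding \<phi>_def \<zeta>_def by (simp add: \<gamma>0)
  moreover have "\<bar>\<phi> T\<bar> = R"
    using \<beta>\<zeta>[of T] \<beta>T T01 by (simp add: \<phi>_def del: tanh_real_abs)
  ultimately have "ennreal R = ennreal \<bar>\<phi> T - \<phi> 0\<bar>"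
    by simp
  also have "\<dots> \<le> (\<integral>\<^sup>+ t \<in> {0..T}. ennreal \<bar>D t\<bar> \<partial>lborel)"
    using DS T01 by (intro variation_le_nn_integral[OF _ S cont\<phi> D]) auto
  also have "\<dots> \<le> curve_length CP1 g \<gamma>"
    unfolding curve_length_def
  proof (rule nn_integral_mono_AE)
    have "AE t in lborel. t \<notin> S"
      using S by (intro AE_not_in finite_imp_null_set_lborel)
    then show "AE t in lborel. ennreal \<bar>D t\<bar> * indicator {0..T} t \<le> ennreal (speed CP1 g \<gamma> t) * indicator {0..1} t"
    proof eventually_elim
      case (elim t)
      then show ?case
        using DS[of t] T01 by (auto simp: indicator_def intro: ennreal_leI)
    qed
  qed
  finally show ?thesis .
qed

section \<open>Convergence of Yang's family\<close>

lemma cylinder_chart: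
  assumes "(U, x) \<in> cylinder"
  shows "open U" "x y = (fst y, cis (snd y))"
proof -
  obtain a where U: "U = {(t, \<theta>). a < \<theta> \<and> \<theta> < a + 2 * pi}" and x: "x = (\<lambda>(t, \<theta>). (t, cis \<theta>))"
    using assms unfolding cylinder_def by blast
  show "open U"
    unfolding U case_prod_beta by (intro open_Collect_conj open_Collect_less continuous_intros)
  show "x y = (fst y, cis (snd y))"
    by (simp add: x case_prod_beta)
qed

lemma cyl_to_C_chart:
  assumes "(U, x) \<in> cylinder"
  shows "cyl_to_C (x y) \<noteq> 0" "ln (cmod (cyl_to_C (x y))) = fst y"
  by (simp_all add: cylinder_chart(2)[OF assms] cyl_to_C_eq_exp)

lemma yang_pair_pullback:
  assumes "yang_pair N' b u g h" "(U, x) \<in> cylinder" "y \<in> U"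
  shows "pullback CP1 cyl_to_CP1 g (U, x) y v w = cyl_tensor (yang_factor N' b u) (U, x) y v w"
proof -
  have "\<forall>c \<in> cylinder. case c of (U, x) \<Rightarrow> \<forall>y \<in> U. \<forall>v w.
      pullback CP1 cyl_to_CP1 g (U, x) y v w = cyl_tensor (yang_factor N' b u) (U, x) y v w"
    using assms(1) unfolding yang_pair_def by blast
  from bspec[OF this assms(2)] show ?thesis
    unfolding case_prod_conv using assms(3) by blast
qed

lemma yang_pair_std_triv:
  assumes "yang_pair N' b u g h" "z \<noteq> 0"
  shows "std_triv h z = exp (u (ln (cmod z))) * exp (- (2 * N' * ln (cmod z)))"
proof -
  have "cmod z ^ N' = exp (N' * ln (cmod z))"
    using assms(2) by (simp add: exp_of_nat_mult)
  then have "(cmod z ^ N')\<^sup>2 = exp (2 * N' * ln (cmod z))"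
    by (simp add: exp_double[symmetric] mult.assoc)
  then have "std_triv h z * exp (2 * N' * ln (cmod z)) = norm_sq (higgs N') h z"
    by (simp add: norm_sq_def higgs_def std_triv_def norm_power)
  also have "\<dots> = exp (u (ln (cmod z)))"
    using assms unfolding yang_pair_def by blast
  finally show ?thesis
    by (simp add: exp_minus field_simps)
qed

text \<open>The conformal factors converge to \<open>2 N' \<ge> 2\<close> uniformly on the region \<open>\<bar>t\<bar> \<le> R\<close>, so
they are eventually at least \<open>1\<close> there.\<close>

lemma yang_dist_to_pole:
  assumes N': "N' \<ge> 1" and u: "\<And>b. b > 0 \<Longrightarrow> yang_solution N' b (u b)"
    and pair: "\<And>b. b > 0 \<Longrightarrow> yang_pair N' b (u b) (g b) (h b)" and R: "R > 0"
  shows "\<forall>\<^sub>F b in at_right 0. \<forall>p q. p \<in> carrier_of cylinder \<and> fst p = 0 \<and>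
      q \<notin> cyl_to_CP1 ` carrier_of cylinder \<longrightarrow> ennreal R \<le> riem_dist CP1 (g b) (cyl_to_CP1 p) q"
proof -
  have "\<forall>\<^sub>F b in at_right 0. \<forall>t\<in>{-R..R}. dist (yang_factor N' b (u b) t) (2 * N') < 1"
    by (rule uniform_limitD[OF yang_factor_uniform_limit[OF N' u compact_Icc] zero_less_one])
  moreover have "\<forall>\<^sub>F b :: real in at_right 0. b > 0"
    by (simp add: eventually_at_right_less)
  ultimately show ?thesis
  proof eventually_elim
    case (elim b)
    have \<rho>: "yang_factor N' b (u b) t \<ge> 1" if "\<bar>t\<bar> \<le> R" for t
    proof -
      have "dist (yang_factor N' b (u b) t) (2 * N') < 1"
        using elim(1) that by (auto simp: abs_le_iff)
      moreover have "real (2 * N') \<ge> 2"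
        using N' by simp
      ultimately show ?thesis
        unfolding dist_real_def by linarith
    qed
    show ?case
      unfolding riem_dist_def
    proof (intro allI impI INF_greatest)
      fix p q \<gamma>
      assume "p \<in> carrier_of cylinder \<and> fst p = 0 \<and> q \<notin> cyl_to_CP1 ` carrier_of cylinder"
        and "\<gamma> \<in> {\<gamma>. piecewise_C1_curve CP1 \<gamma> \<and> \<gamma> 0 = cyl_to_CP1 p \<and> \<gamma> 1 = q}"
      then show "ennreal R \<le> curve_length CP1 (g b) \<gamma>"
        by (intro curve_length_to_pole[OF yang_pair_pullback[OF pair[OF elim(2)]] \<rho> R, of \<gamma> p]) auto
    qed
  qed
qed

theorem mainTheorem6:
  fixes N' N :: nat
    and u :: "real \<Rightarrow> real \<Rightarrow> real"
    and g :: "real \<Rightarrow> (complex, (complex \<times> complex) set) tensor2"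
    and h :: "real \<Rightarrow> complex \<times> complex \<Rightarrow> real"
  assumes "N' \<ge> 1" and "N = 2 * N'"
    and "\<And>b. b > 0 \<Longrightarrow> yang_solution N' b (u b)"
    and "\<And>b. b > 0 \<Longrightarrow> yang_pair N' b (u b) (g b) (h b)"
  shows "((\<lambda>b. riem_diam CP1 (g b)) \<longlongrightarrow> \<infinity>) (at_right 0) \<and>
    smooth_conv_tensor2 cylinder (\<lambda>b. pullback CP1 cyl_to_CP1 (g b))
      (cyl_tensor (\<lambda>t. real N)) (at_right 0) \<and>
    smooth_conv cylinder (\<lambda>b p. std_triv (h b) (cyl_to_C p))
      (\<lambda>p. h_infty N' (cyl_to_C p)) (at_right 0) \<and>
    (\<forall>z v w. z \<noteq> 0 \<longrightarrow> chern_curvature (h_infty N') z v w = 0) \<and>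
    smooth_conv cylinder (\<lambda>b p. norm_sq (higgs N') (h b) (cyl_to_C p)) (\<lambda>p. 1) (at_right 0) \<and>
    (\<forall>p \<in> carrier_of cylinder. fst p = 0 \<longrightarrow>
       pointed_cheeger_gromov (\<lambda>b. CP1) g (\<lambda>b. cyl_to_CP1 p)
         cylinder (cyl_tensor (\<lambda>t. real N)) p (at_right 0))"
proof -
  note N' = assms(1) and u = assms(3) and pair = assms(4)
  let ?R = "generated_ring (yang_generators N' u)"
  have pos: "\<forall>\<^sub>F b :: real in at_right 0. b > 0"
    by (simp add: eventually_at_right_less)
  have limit: "smooth_limit K (\<lambda>b y. f b (fst y)) (\<lambda>y. l (fst y)) (at_right 0)"
    if "(f, l) \<in> ?R" "compact K" for f l and K :: "(real \<times> real) set"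
    by (rule yang_smooth_limit[OF N' u that])
  have far: "\<forall>\<^sub>F b in at_right 0. \<forall>p q. p \<in> carrier_of cylinder \<and> fst p = 0 \<and>
      q \<notin> cyl_to_CP1 ` carrier_of cylinder \<longrightarrow> ennreal R \<le> riem_dist CP1 (g b) (cyl_to_CP1 p) q"
    if "R > 0" for R
    by (rule yang_dist_to_pole[OF N' u pair that])

  have diam: "((\<lambda>b. riem_diam CP1 (g b)) \<longlongrightarrow> \<infinity>) (at_right 0)"
  proof (rule order_tendstoI)
    fix a :: ennreal assume "a < \<infinity>"
    then obtain r where r: "r \<ge> 0" "a = ennreal r"
      by (cases a) auto
    define p :: "real \<times> complex" where "p = (0, 1)"
    have p: "p \<in> carrier_of cylinder" "fst p = 0"
      by (auto simp: p_def carrier_cylinder)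
    have carrier: "cyl_to_CP1 p \<in> carrier_of CP1" "proj (1, 0) \<in> carrier_of CP1"
      by (auto simp: cyl_to_CP1_def carrier_CP1)
    have pole: "proj (1, 0) \<notin> cyl_to_CP1 ` carrier_of cylinder"
      unfolding cyl_to_CP1_image by auto
    have "r + 1 > 0"
      using r by simp
    from far[OF this] show "\<forall>\<^sub>F b in at_right 0. a < riem_diam CP1 (g b)"
    proof eventually_elim
      case (elim b)
      have "a < ennreal (r + 1)"
        using r by (simp add: ennreal_lessI)
      also have "\<dots> \<le> riem_dist CP1 (g b) (cyl_to_CP1 p) (proj (1, 0))"
        using elim p pole by blast
      also have "\<dots> \<le> riem_diam CP1 (g b)"
        unfolding riem_diam_def by (rule SUP_upper2[OF carrier(1) SUP_upper[OF carrier(2)]])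
      finally show ?case .
    qed
  qed (simp add: not_less)

  have tensor: "smooth_conv_tensor2 cylinder (\<lambda>b. pullback CP1 cyl_to_CP1 (g b))
      (cyl_tensor (\<lambda>t. real N)) (at_right 0)"
    unfolding smooth_conv_tensor2_def
  proof (clarify)
    fix U x K and v w :: "real \<times> real"
    assume c: "(U, x) \<in> cylinder" and K: "compact K" "K \<subseteq> U"
    have "(\<lambda>b t. yang_factor N' b (u b) t * (v \<bullet> w), \<lambda>t. real (2 * N') * (v \<bullet> w)) \<in> ?R"
      by (intro generated_ring.mult[OF generated_ring.gen generated_ring.const])
        (simp add: yang_generators_def)
    from limit[OF this K(1)]
    show "smooth_limit K (\<lambda>b y. pullback CP1 cyl_to_CP1 (g b) (U, x) y v w)
        (\<lambda>y. cyl_tensor (\<lambda>t. real N) (U, x) y v w) (at_right 0)"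
    proof (rule smooth_limit_cong_open[OF cylinder_chart(1)[OF c] K(2), rotated 2])
      show "\<forall>\<^sub>F b in at_right 0. \<forall>y\<in>U. pullback CP1 cyl_to_CP1 (g b) (U, x) y v w =
          yang_factor N' b (u b) (fst y) * (v \<bullet> w)"
        using pos by eventually_elim (simp add: yang_pair_pullback[OF pair _ ] c cyl_tensor_def)
    qed (simp add: cyl_tensor_def assms(2))
  qed

  have herm: "smooth_conv cylinder (\<lambda>b p. std_triv (h b) (cyl_to_C p))
      (\<lambda>p. h_infty N' (cyl_to_C p)) (at_right 0)"
    unfolding smooth_conv_def
  proof (clarify)
    fix U x and K :: "(real \<times> real) set"
    assume c: "(U, x) \<in> cylinder" and K: "compact K" "K \<subseteq> U"
    have "(\<lambda>b t. ((exp (u b t) - 1) + 1) * exp (- (2 * N' * t)), \<lambda>t. (0 + 1) * exp (- (2 * N' * t))) \<in> ?R"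
      by (intro generated_ring.mult[OF generated_ring.add[OF generated_ring.gen generated_ring.const]
            generated_ring.gen]) (simp_all add: yang_generators_def)
    from limit[OF this K(1)]
    show "smooth_limit K (\<lambda>b. (\<lambda>p. std_triv (h b) (cyl_to_C p)) \<circ> x) ((\<lambda>p. h_infty N' (cyl_to_C p)) \<circ> x)
        (at_right 0)"
    proof (rule smooth_limit_cong_open[OF cylinder_chart(1)[OF c] K(2), rotated 2])
      show "\<forall>\<^sub>F b in at_right 0. \<forall>y\<in>U. ((\<lambda>p. std_triv (h b) (cyl_to_C p)) \<circ> x) y =
          ((exp (u b (fst y)) - 1) + 1) * exp (- (2 * N' * fst y))"
        using pos
        by eventually_elim (simp add: yang_pair_std_triv[OF pair] cyl_to_C_chart[OF c])
    qed (simp add: h_infty_def cyl_to_C_chart[OF c])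
  qed

  have higgs: "smooth_conv cylinder (\<lambda>b p. norm_sq (higgs N') (h b) (cyl_to_C p)) (\<lambda>p. 1) (at_right 0)"
    unfolding smooth_conv_def
  proof (clarify)
    fix U x and K :: "(real \<times> real) set"
    assume c: "(U, x) \<in> cylinder" and K: "compact K" "K \<subseteq> U"
    have "(\<lambda>b t. (exp (u b t) - 1) + 1, \<lambda>t. 0 + 1) \<in> ?R"
      by (intro generated_ring.add[OF generated_ring.gen generated_ring.const])
        (simp add: yang_generators_def)
    from limit[OF this K(1)]
    show "smooth_limit K (\<lambda>b. (\<lambda>p. norm_sq (higgs N') (h b) (cyl_to_C p)) \<circ> x) ((\<lambda>p. 1) \<circ> x) (at_right 0)"
    proof (rule smooth_limit_cong_open[OF cylinder_chart(1)[OF c] K(2), rotated 2])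
      have norm: "norm_sq (higgs N') (h b) z = exp (u b (ln (cmod z)))" if "b > 0" "z \<noteq> 0" for b z
        using pair[OF that(1)] that(2) unfolding yang_pair_def by blast
      show "\<forall>\<^sub>F b in at_right 0. \<forall>y\<in>U. ((\<lambda>p. norm_sq (higgs N') (h b) (cyl_to_C p)) \<circ> x) y =
          (exp (u b (fst y)) - 1) + 1"
        using pos by eventually_elim (simp add: norm cyl_to_C_chart[OF c])
    qed simp
  qed

  have "pointed_cheeger_gromov (\<lambda>b. CP1) g (\<lambda>b. cyl_to_CP1 p)
      cylinder (cyl_tensor (\<lambda>t. real N)) p (at_right 0)"
    if p: "p \<in> carrier_of cylinder" "fst p = 0" for p
    unfolding pointed_cheeger_gromov_def
  \<comment> \<open>The whole cylinder, embedded for every \<open>b\<close> as the complement of the poles, serves as a constant exhaustion.\<close>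
  proof (intro exI[of _ "\<lambda>b. carrier_of cylinder"] exI[of _ "\<lambda>b. cyl_to_CP1"] conjI allI impI tensor)
    show "\<forall>\<^sub>F b :: real in at_right 0. p \<in> carrier_of cylinder \<and>
        diffeo_onto_open cylinder CP1 (carrier_of cylinder) cyl_to_CP1 \<and> cyl_to_CP1 p = cyl_to_CP1 p"
      using p diffeo_cyl_to_CP1 by simp
    have "carrier_of cylinder \<supseteq> topspace (manifold_topology cylinder)"
      unfolding topspace_def by (auto simp: openin_manifold_topology[OF cylinder_chart(1)])
    then show "\<forall>\<^sub>F b :: real in at_right 0. K \<subseteq> carrier_of cylinder"
      if "compactin (manifold_topology cylinder) K" for K
      using compactin_subset_topspace[OF that] by simp
    fix r :: real assume "r > 0"
    from far[OF this]
    show "\<forall>\<^sub>F b in at_right 0. riem_ball CP1 (g b) (cyl_to_CP1 p) r \<subseteq> cyl_to_CP1 ` carrier_of cylinder"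
    proof eventually_elim
      case (elim b)
      then show ?case
        using p unfolding riem_ball_def by (metis (mono_tags, lifting) linorder_not_less mem_Collect_eq subsetI)
    qed
  qed
  with diam tensor herm higgs chern_curvature_h_infty show ?thesis
    by blast
qed

end
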